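(* Let $X_{rad}(x)=|\mathbb S^4|^{-1}\frac{x}{|x|^5}$ on $\mathbb B^5$. Consider the class of vector fields $X\in L^1(\mathbb B^5,\mathbb R^5)$ for which there is a finite set $\Sigma\subset\mathbb B^5$ such that $X$ is smooth on $\mathbb B^5\setminus\Sigma$, and integers $(d_x)_{x\in\Sigma}$ such that $\mathrm{div}X\llcorner\mathbb B^5=\sum_{x\in\Sigma}d_x\delta_x$ and the outward normal component of $X$ on $\partial\mathbb B^5$ equals $|\mathbb S^4|^{-1}$; equivalently, for every $f\in C^\infty(\overline{\mathbb B^5})$, \[ \int_{\mathbb B^5}X\cdot\nabla f\,dx=-\sum_{x\in\Sigma}d_x f(x)+|\mathbb S^4|^{-1}\int_{\mathbb S^4}f\,d\mathcal H^4 . \] Then $X_{rad}$ belongs to this class and minimizes $\int_{\mathbb B^5}|X|\,dx$ over it.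
   Context: $\mathbb B^5$ is the open unit ball in $\mathbb R^5$, $\mathbb S^4=\partial\mathbb B^5$, $|\mathbb S^4|$ is its $4$-dimensional measure, $\delta_x$ the Dirac mass at $x$. *)

theory Defs
  imports "HOL-Analysis.Analysis"
begin

text \<open>C^k regularity on a set U (intended for open U): C^0 = continuous,
  C^(k+1) = differentiable with all directional derivatives of class C^k.\<close>
fun Ck_on :: "nat \<Rightarrow> 'a::euclidean_space set \<Rightarrow> ('a \<Rightarrow> 'b::real_normed_vector) \<Rightarrow> bool" where
  "Ck_on 0 U f = continuous_on U f"
| "Ck_on (Suc k) U f =
     (f differentiable_on U \<and> (\<forall>v. Ck_on k U (\<lambda>x. frechet_derivative f (at x) v)))"

definition smooth_on :: "'a::euclidean_space set \<Rightarrow> ('a \<Rightarrow> 'b::real_normed_vector) \<Rightarrow> bool" where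
  "smooth_on U f \<longleftrightarrow> (\<forall>k. Ck_on k U f)"

definition grad :: "(real^5 \<Rightarrow> real) \<Rightarrow> real^5 \<Rightarrow> real^5" where
  "grad f x = (\<chi> i. frechet_derivative f (at x) (axis i 1))"

text \<open>Integral over the unit sphere S^4 w.r.t. the 4-dimensional Hausdorff (surface)
  measure, expressed via polar coordinates:
  integral over S^4 of g = 5 * integral over B^5 of g(x/|x|) dx.\<close>
definition sphere_integral :: "(real^5 \<Rightarrow> real) \<Rightarrow> real" where
  "sphere_integral g = 5 * (LINT x : ball 0 1 | lebesgue. g (x /\<^sub>R norm x))"

definition S4_area :: real where
  "S4_area = sphere_integral (\<lambda>_. 1)"

definition Xrad :: "real^5 \<Rightarrow> real^5" where
  "Xrad x = (1 / S4_area) *\<^sub>R (x /\<^sub>R (norm x ^ 5))"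

definition admissible :: "(real^5 \<Rightarrow> real^5) \<Rightarrow> bool" where
  "admissible X \<longleftrightarrow>
     set_integrable lebesgue (ball 0 1) X \<and>
     (\<exists>S (d :: real^5 \<Rightarrow> int). finite S \<and> S \<subseteq> ball 0 1 \<and>
        smooth_on (ball 0 1 - S) X \<and>
        (\<forall>f U. open U \<and> cball 0 1 \<subseteq> U \<and> smooth_on U f \<longrightarrow>
           (LINT x : ball 0 1 | lebesgue. X x \<bullet> grad f x)
             = - (\<Sum>p\<in>S. of_int (d p) * f p) + sphere_integral f / S4_area))"

end

theory Submission
  imports Defs
begin

text \<open>
  In polar coordinates the flux identity for the radial field is the fundamental theorem of
  calculus along rays, and the same coordinates give the radial field mass \<open>1\<close>.

  For an arbitrary competitor, write the divergence as a sum of unit positive charges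
  \<open>P\<^sub>0, \<dots>, P\<^sub>m\<close> and unit negative charges \<open>N\<^sub>1, \<dots>, N\<^sub>m\<close>; testing with a constant shows that there
  is exactly one more positive charge. Let \<open>C(x)\<close> be the minimal cost of matching the \<open>P\<^sub>i\<close> with the
  \<open>N\<^sub>j\<close> together with one additional negative charge at \<open>x\<close>. This is a 1-Lipschitz function of \<open>x\<close>, so
  the mass of the field is at least \<open>\<Sum> C(N\<^sub>j) - \<Sum> C(P\<^sub>i)\<close> plus the mean of \<open>C\<close> over the sphere.
  Recombining optimal matchings shows that the difference of the sums is nonnegative, and
  superposing matchings for \<open>y\<close> and \<open>-y\<close> leaves a transport from \<open>y\<close> to \<open>-y\<close>, so that
  \<open>C(y) + C(-y) \<ge> 2\<close> and the mean of \<open>C\<close> is at least \<open>1\<close>. Since \<open>C\<close> is a minimum of finitely many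
  functions \<open>|x - q| + c\<close>, a soft minimum provides smooth 1-Lipschitz test functions close to \<open>C\<close>.
\<close>

subsection \<open>Minimal matchings\<close>

text \<open>Slot \<open>0\<close> holds the extra negative charge at \<open>x\<close>, slots
  \<open>1..m\<close> hold the charges \<open>N\<close>. A perfect matching with the
  \<open>m + 1\<close> positive charges is then just a permutation of \<open>{..m}\<close>.\<close>

definition matching_cost :: "(nat \<Rightarrow> 'a::metric_space) \<Rightarrow> (nat \<Rightarrow> 'a) \<Rightarrow> nat \<Rightarrow> 'a \<Rightarrow> (nat \<Rightarrow> nat) \<Rightarrow> real" where
  "matching_cost P N m x \<sigma> = dist x (P (\<sigma> 0)) + (\<Sum>i=1..m. dist (N i) (P (\<sigma> i)))"

definition min_matching :: "(nat \<Rightarrow> 'a::metric_space) \<Rightarrow> (nat \<Rightarrow> 'a) \<Rightarrow> nat \<Rightarrow> 'a \<Rightarrow> real" where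
  "min_matching P N m x = Min (matching_cost P N m x ` {\<sigma>. \<sigma> permutes {..m}})"

lemma finite_permutations_atMost: "finite {\<sigma>. \<sigma> permutes {..m::nat}}"
  by (simp add: finite_permutations)

lemma min_matching_le:
  assumes "\<sigma> permutes {..m}"
  shows "min_matching P N m x \<le> matching_cost P N m x \<sigma>"
  unfolding min_matching_def using assms by (intro Min_le) (auto simp: finite_permutations)

lemma min_matching_attained:
  obtains \<sigma> where "\<sigma> permutes {..m}" "min_matching P N m x = matching_cost P N m x \<sigma>"
proof -
  have "{\<sigma>. \<sigma> permutes {..m}} \<noteq> {}"
    using permutes_id by blast
  then have "min_matching P N m x \<in> matching_cost P N m x ` {\<sigma>. \<sigma> permutes {..m}}"
    unfolding min_matching_def by (intro Min_in) (auto simp: finite_permutations)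
  then show ?thesis using that by blast
qed

text \<open>Weak Kantorovich duality: along a matched pair the potential \<open>h\<close> drops by
  at most the length of the pair, and the sum of the drops is the same for every perfect
  matching.\<close>

lemma min_matching_lower_bound:
  fixes h :: "'a::metric_space \<Rightarrow> real"
  assumes h: "\<And>a b. h a - h b \<le> dist a b"
  shows "h x + (\<Sum>i=1..m. h (N i)) - (\<Sum>i\<le>m. h (P i)) \<le> min_matching P N m x"
proof -
  obtain \<sigma> where \<sigma>: "\<sigma> permutes {..m}" "min_matching P N m x = matching_cost P N m x \<sigma>"
    by (rule min_matching_attained)
  have "(\<Sum>i\<le>m. h (P i)) = (\<Sum>i\<le>m. h (P (\<sigma> i)))"
    using sum.permute[OF \<sigma>(1), of "\<lambda>i. h (P i)"] by (simp add: o_def)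
  also have "\<dots> = h (P (\<sigma> 0)) + (\<Sum>i=1..m. h (P (\<sigma> i)))"
    by (simp add: sum.atLeast1_atMost_eq sum.atMost_shift lessThan_Suc_atMost)
  finally have "h x + (\<Sum>i=1..m. h (N i)) - (\<Sum>i\<le>m. h (P i)) =
      (h x - h (P (\<sigma> 0))) + (\<Sum>i=1..m. h (N i) - h (P (\<sigma> i)))"
    by (simp add: sum_subtractf)
  also have "\<dots> \<le> matching_cost P N m x \<sigma>"
    unfolding matching_cost_def by (intro add_mono h sum_mono)
  finally show ?thesis by (simp add: \<sigma>)
qed

text \<open>The superposition of two matchings is seen in dual form: the potential
  \<open>\<lambda>a. dist a z\<close> serves for \<open>y\<close>, its negative for
  \<open>z\<close>. On adding the two bounds all contributions of \<open>P\<close> and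
  \<open>N\<close> cancel.\<close>

lemma min_matching_add_ge_dist: "dist y z \<le> min_matching P N m y + min_matching P N m z"
proof -
  have 1: "dist a z - dist b z \<le> dist a b" for a b
    using dist_triangle[of a z b] by simp
  have 2: "- dist a z - - dist b z \<le> dist a b" for a b
    using dist_triangle[of b z a] by (simp add: dist_commute)
  show ?thesis
    using min_matching_lower_bound[of "\<lambda>a. dist a z" y N m P, OF 1]
      min_matching_lower_bound[of "\<lambda>a. - dist a z" z N m P, OF 2]
    by (simp add: sum_negf)
qed

section \<open>Permutations and their invariant sets\<close>

lemma permutes_if_invariant:
  assumes "\<sigma> permutes A" "Z \<subseteq> A" "\<sigma> ` Z = Z"
  shows "(\<lambda>i. if i \<in> Z then \<sigma> i else i) permutes A"
    and "(\<lambda>i. if i \<in> Z then i else \<sigma> i) permutes A"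
proof -
  have inj: "inj \<sigma>" using assms(1) by (rule permutes_inj)
  have c: "\<sigma> ` (- Z) = - Z"
    using bij_image_Compl_eq[OF permutes_bij[OF assms(1)], of Z] assms(3) by simp
  \<comment> \<open>Since the complement of \<open>Z\<close> is invariant too, values from the two
    branches of the glued maps never collide.\<close>
  have mem: "\<sigma> i \<in> Z \<longleftrightarrow> i \<in> Z" for i
    using assms(3) c by (metis ComplD ComplI imageI)
  have surj: "\<exists>i. \<sigma> i = y" for y
    using permutes_surj[OF assms(1)] by (metis surjD)
  have "bij (\<lambda>i. if i \<in> Z then \<sigma> i else i)"
    unfolding bij_def
  proof
    show "inj (\<lambda>i. if i \<in> Z then \<sigma> i else i)"
      by (rule injI) (auto split: if_splits simp: mem dest: injD[OF inj])
    show "surj (\<lambda>i. if i \<in> Z then \<sigma> i else i)"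
      unfolding surj_def by (metis mem surj)
  qed
  moreover have "bij (\<lambda>i. if i \<in> Z then i else \<sigma> i)"
    unfolding bij_def
  proof
    show "inj (\<lambda>i. if i \<in> Z then i else \<sigma> i)"
      by (rule injI) (auto split: if_splits simp: mem dest: injD[OF inj])
    show "surj (\<lambda>i. if i \<in> Z then i else \<sigma> i)"
      unfolding surj_def by (metis mem surj)
  qed
  moreover have "\<sigma> i = i" if "i \<notin> A" for i
    using assms(1) that by (simp add: permutes_not_in)
  ultimately show "(\<lambda>i. if i \<in> Z then \<sigma> i else i) permutes A"
    and "(\<lambda>i. if i \<in> Z then i else \<sigma> i) permutes A"
    using assms(2) by (simp_all add: permutes_def bij_iff subset_iff)
qed

text \<open>Composing with the transposition of \<open>a\<close> and \<open>b\<close> splits a cycle through both points in two.\<close>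

lemma separating_invariant_set:
  fixes \<sigma> :: "'a \<Rightarrow> 'a"
  assumes \<sigma>: "\<sigma> permutes A" and fin: "finite A" and ab: "a \<in> A" "b \<in> A" "a \<noteq> b"
  obtains \<tau> Z where "\<tau> = \<sigma> \<or> \<tau> = \<sigma> \<circ> Transposition.transpose a b" "\<tau> ` Z = Z" "Z \<subseteq> A" "b \<in> Z" "a \<notin> Z"
proof (cases "\<exists>k. (\<sigma> ^^ k) b = a")
  case False
  \<comment> \<open>The orbit of \<open>b\<close> misses \<open>a\<close>, so it separates the
    points without any transposition; finiteness turns forward invariance into invariance.\<close>
  define Z where "Z = {(\<sigma> ^^ k) b |k. True}"
  have inA: "(\<sigma> ^^ k) b \<in> A" for k
    by (induction k) (auto simp: ab permutes_in_image[OF \<sigma>])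
  then have ZA: "Z \<subseteq> A" by (auto simp: Z_def)
  have "\<sigma> ` Z \<subseteq> Z"
    unfolding Z_def by (auto intro: exI[of _ "Suc _"])
  then have "\<sigma> ` Z = Z"
    using ZA fin \<sigma> by (metis endo_inj_surj finite_subset inj_on_subset permutes_inj subset_UNIV)
  moreover have "b \<in> Z" unfolding Z_def by (auto intro: exI[of _ 0])
  moreover have "a \<notin> Z" using False by (auto simp: Z_def)
  ultimately show ?thesis using that ZA by blast
next
  case True
  define k where "k = (LEAST k. (\<sigma> ^^ k) b = a)"
  have k: "(\<sigma> ^^ k) b = a" unfolding k_def using True by (rule LeastI_ex)
  have kmin: "(\<sigma> ^^ i) b \<noteq> a" if "i < k" for i
    using that not_less_Least unfolding k_def by blast
  have k0: "k \<noteq> 0" using k ab by (metis funpow_0)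
  \<comment> \<open>An earlier return to \<open>b\<close> would give a shorter way to
    \<open>a\<close>, against the minimality of \<open>k\<close>.\<close>
  have nb: "(\<sigma> ^^ i) b \<noteq> b" if "0 < i" "i \<le> k" for i
  proof
    assume *: "(\<sigma> ^^ i) b = b"
    have "(\<sigma> ^^ (k - i)) b = (\<sigma> ^^ (k - i)) ((\<sigma> ^^ i) b)" by (simp add: *)
    also have "\<dots> = (\<sigma> ^^ k) b" using that by (metis comp_apply funpow_add le_add_diff_inverse2)
    finally have "(\<sigma> ^^ (k - i)) b = a" using k by simp
    then show False using kmin[of "k - i"] that k0 by simp
  qed
  \<comment> \<open>The arc of the cycle from \<open>\<sigma> b\<close> to \<open>a\<close>. The
    transposition redirects \<open>a\<close> to \<open>\<sigma> b\<close> and changes nothing else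
    on the arc, which thus closes up.\<close>
  define W where "W = {(\<sigma> ^^ i) b |i. 0 < i \<and> i \<le> k}"
  define \<tau> where "\<tau> = \<sigma> \<circ> Transposition.transpose a b"
  have \<tau>: "\<tau> permutes A"
    unfolding \<tau>_def using ab by (intro permutes_compose[OF _ \<sigma>] permutes_swap_id)
  have inA: "(\<sigma> ^^ k) b \<in> A" for k
    by (induction k) (auto simp: ab permutes_in_image[OF \<sigma>])
  then have WA: "W \<subseteq> A" by (auto simp: W_def)
  have "\<tau> y \<in> W" if "y \<in> W" for y
  proof -
    from that obtain i where i: "y = (\<sigma> ^^ i) b" "0 < i" "i \<le> k" by (auto simp: W_def)
    show ?thesis
    proof (cases "i = k")
      case True
      then have "y = a" using i k by simp
      then have "\<tau> y = (\<sigma> ^^ 1) b" by (simp add: \<tau>_def)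
      then show ?thesis unfolding W_def using k0 by (intro CollectI exI[of _ 1]) auto
    next
      case False
      then have "y \<noteq> a" "y \<noteq> b" using i kmin[of i] nb[of i] by auto
      then have "\<tau> y = (\<sigma> ^^ Suc i) b" by (simp add: \<tau>_def i Transposition.transpose_def)
      then show ?thesis unfolding W_def using i False by (intro CollectI exI[of _ "Suc i"]) auto
    qed
  qed
  then have "\<tau> ` W \<subseteq> W" by blast
  then have "\<tau> ` W = W"
    using WA fin \<tau> by (metis endo_inj_surj finite_subset inj_on_subset permutes_inj subset_UNIV)
  \<comment> \<open>\<open>W\<close> contains \<open>a\<close> but not \<open>b\<close>, so the set
    asked for is its complement.\<close>
  then have "\<tau> ` (A - W) = A - W"
    using permutes_image[OF \<tau>] image_set_diff[OF permutes_inj[OF \<tau>]] by metis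
  moreover have "b \<in> A - W" using ab by (auto simp: W_def dest: sym nb)
  moreover have "a \<notin> A - W" using k k0 by (auto simp: W_def)
  ultimately show ?thesis using that[of \<tau> "A - W"] \<tau>_def by blast
qed

text \<open>
  In an optimal matching \<open>\<tau>\<close> for the extra charge at \<open>N\<^sub>j\<close>, the slots \<open>0\<close> and \<open>j\<close> are both located
  at \<open>N\<^sub>j\<close> and may be swapped, so some \<open>\<tau>\<close>-invariant set \<open>Z\<close> contains \<open>j\<close> but not \<open>0\<close>. The union of
  \<open>\<tau>\<close> and the identity matching, without the edge from \<open>N\<^sub>j\<close> to \<open>P\<^sub>j\<close>, is then redistributed into a
  matching \<open>\<alpha>\<close> leaving out \<open>P\<^sub>0\<close> and a matching (\<open>\<beta>\<close> with \<open>0\<close> and \<open>j\<close> swapped) leaving out \<open>P\<^sub>j\<close>.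
\<close>

lemma sum_min_matching_le_aux:
  fixes P N :: "nat \<Rightarrow> 'a::metric_space"
  assumes opt: "\<And>\<sigma>. \<sigma> permutes {..m} \<Longrightarrow>
     (\<Sum>i=1..m. dist (N i) (P i)) \<le> (\<Sum>i=1..m. dist (N i) (P (\<sigma> i)))"
  shows "(\<Sum>i\<le>m. min_matching P N m (P i)) \<le> (\<Sum>i=1..m. min_matching P N m (N i))"
proof -
  have step: "min_matching P N m (P j) + dist (N j) (P j) \<le> min_matching P N m (N j)"
    if j: "j \<in> {1..m}" for j
  proof -
    obtain \<sigma> where \<sigma>: "\<sigma> permutes {..m}" "min_matching P N m (N j) = matching_cost P N m (N j) \<sigma>"
      by (rule min_matching_attained)
    obtain \<tau> Z where \<tau>: "\<tau> = \<sigma> \<or> \<tau> = \<sigma> \<circ> Transposition.transpose 0 j" and Z: "\<tau> ` Z = Z" "Z \<subseteq> {..m}" "j \<in> Z" "0 \<notin> Z"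
      using separating_invariant_set[OF \<sigma>(1), of 0 j] j by auto
    have p\<tau>: "\<tau> permutes {..m}"
      using \<tau> \<sigma>(1) j by (auto intro!: permutes_compose permutes_swap_id)
    have swap: "matching_cost P N m (N j) (\<sigma> \<circ> Transposition.transpose 0 j) = matching_cost P N m (N j) \<sigma>"
    proof -
      have "(\<Sum>i\<in>{1..m}-{j}. dist (N i) (P ((\<sigma> \<circ> Transposition.transpose 0 j) i))) = (\<Sum>i\<in>{1..m}-{j}. dist (N i) (P (\<sigma> i)))"
        by (intro sum.cong) (auto simp: Transposition.transpose_def)
      then show ?thesis
        unfolding matching_cost_def using j by (simp add: sum.remove[of _ j])
    qed
    have cost: "min_matching P N m (N j) = matching_cost P N m (N j) \<tau>"
      using \<tau> \<sigma>(2) swap by auto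
    have Z1: "Z \<subseteq> {1..m}" using Z(2,4) by (auto simp: Suc_le_eq intro: gr0I)
    define \<alpha> where "\<alpha> = (\<lambda>i. if i \<in> Z then \<tau> i else i)"
    define \<beta> where "\<beta> = (\<lambda>i. if i \<in> Z then i else \<tau> i)"
    have perms: "\<alpha> permutes {..m}" "\<beta> permutes {..m}"
      unfolding \<alpha>_def \<beta>_def using permutes_if_invariant[OF p\<tau> Z(2,1)] by auto
    have split: "(\<Sum>i=1..m. g i) = (\<Sum>i\<in>{1..m}-Z. g i) + (\<Sum>i\<in>Z. g i)" for g :: "nat \<Rightarrow> real"
      using Z1 by (simp add: sum.subset_diff)
    have finZ: "finite Z" using Z1 finite_subset by blast
    have eq1: "(\<Sum>i\<in>{1..m}-Z. dist (N i) (P (\<alpha> i))) = (\<Sum>i\<in>{1..m}-Z. dist (N i) (P i))"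
      by (intro sum.cong) (auto simp: \<alpha>_def)
    have eq2: "(\<Sum>i\<in>Z. dist (N i) (P (\<alpha> i))) = (\<Sum>i\<in>Z. dist (N i) (P (\<tau> i)))"
      by (intro sum.cong) (auto simp: \<alpha>_def)
    \<comment> \<open>Because \<open>\<alpha>\<close> is the identity off \<open>Z\<close>,
      optimality of the identity localizes to \<open>Z\<close>.\<close>
    have A: "(\<Sum>i\<in>Z. dist (N i) (P i)) \<le> (\<Sum>i\<in>Z. dist (N i) (P (\<tau> i)))"
      using opt[OF perms(1)] unfolding split eq1 eq2 by simp
    \<comment> \<open>Here \<open>\<beta> j = j\<close> and \<open>\<beta> 0 = \<tau> 0\<close>.
      After the swap the extra charge at \<open>P j\<close> meets \<open>P j\<close> at no cost, and
      \<open>N j\<close> takes over the partner \<open>P (\<tau> 0)\<close>.\<close>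
    have "\<beta> \<circ> Transposition.transpose 0 j permutes {..m}"
      using j by (intro permutes_compose[OF _ perms(2)] permutes_swap_id) auto
    then have "min_matching P N m (P j) \<le> matching_cost P N m (P j) (\<beta> \<circ> Transposition.transpose 0 j)"
      by (rule min_matching_le)
    also have "\<dots> = (\<Sum>i\<in>{1..m}-Z. dist (N i) (P (\<tau> i))) + (dist (N j) (P (\<tau> 0)) + (\<Sum>i\<in>Z-{j}. dist (N i) (P i)))"
    proof -
      have "(\<Sum>i\<in>{1..m}-Z. dist (N i) (P ((\<beta> \<circ> Transposition.transpose 0 j) i))) = (\<Sum>i\<in>{1..m}-Z. dist (N i) (P (\<tau> i)))"
        using Z(3) by (intro sum.cong) (auto simp: \<beta>_def Transposition.transpose_def)
      moreover have "(\<Sum>i\<in>Z-{j}. dist (N i) (P ((\<beta> \<circ> Transposition.transpose 0 j) i))) = (\<Sum>i\<in>Z-{j}. dist (N i) (P i))"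
        using Z(4) by (intro sum.cong) (auto simp: \<beta>_def Transposition.transpose_def)
      ultimately show ?thesis
        unfolding matching_cost_def split sum.remove[OF finZ Z(3)]
        using Z(3,4) by (simp add: \<beta>_def)
    qed
    also have "\<dots> + dist (N j) (P j) = (\<Sum>i\<in>{1..m}-Z. dist (N i) (P (\<tau> i))) + dist (N j) (P (\<tau> 0)) + (\<Sum>i\<in>Z. dist (N i) (P i))"
      by (simp add: sum.remove[OF finZ Z(3)])
    also have "\<dots> \<le> matching_cost P N m (N j) \<tau>"
      unfolding matching_cost_def split using A by simp
    finally show ?thesis using cost by simp
  qed
  \<comment> \<open>Under the identity the extra charge at \<open>P 0\<close> is matched for free.
    The rest of the cost is paid by the surplus terms \<open>dist (N j) (P j)\<close> in
    \<open>step\<close>.\<close>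
  have "min_matching P N m (P 0) \<le> (\<Sum>i=1..m. dist (N i) (P i))"
    using min_matching_le[of id m P N "P 0"] by (simp add: matching_cost_def permutes_id)
  moreover have "(\<Sum>i=1..m. min_matching P N m (P i) + dist (N i) (P i)) \<le> (\<Sum>i=1..m. min_matching P N m (N i))"
    by (intro sum_mono step)
  moreover have "(\<Sum>i\<le>m. min_matching P N m (P i)) = min_matching P N m (P 0) + (\<Sum>i=1..m. min_matching P N m (P i))"
    by (simp add: sum.atLeast1_atMost_eq sum.atMost_shift lessThan_Suc_atMost)
  ultimately show ?thesis by (simp add: sum.distrib)
qed

text \<open>Reduction to an optimal identity: relabel the positive charges by a permutation
  \<open>\<rho>\<close> that minimizes the cost of slots \<open>1..m\<close>. Neither the minimal
  cost nor the sum over \<open>P\<close> depends on the labelling.\<close>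

lemma sum_min_matching_le:
  fixes P N :: "nat \<Rightarrow> 'a::metric_space"
  shows "(\<Sum>i\<le>m. min_matching P N m (P i)) \<le> (\<Sum>i=1..m. min_matching P N m (N i))"
proof -
  define R where "R = (\<lambda>\<sigma>. \<Sum>i=1..m. dist (N i) (P (\<sigma> i)))"
  define \<rho> where "\<rho> = arg_min_on R {\<sigma>. \<sigma> permutes {..m}}"
  have ne: "{\<sigma>. \<sigma> permutes {..m}} \<noteq> {}" using permutes_id by blast
  have \<rho>: "\<rho> permutes {..m}"
    using arg_min_if_finite(1)[OF finite_permutations_atMost[of m] ne, of R] by (simp add: \<rho>_def)
  have min: "R \<rho> \<le> R \<sigma>" if "\<sigma> permutes {..m}" for \<sigma>
    unfolding \<rho>_def using arg_min_least[OF finite_permutations_atMost[of m] ne, of \<sigma> R] that by simp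
  have comp: "matching_cost (P \<circ> \<rho>) N m x \<sigma> = matching_cost P N m x (\<rho> \<circ> \<sigma>)" for x \<sigma>
    by (simp add: matching_cost_def)
  have img: "(\<lambda>\<sigma>. \<rho> \<circ> \<sigma>) ` {\<sigma>. \<sigma> permutes {..m}} = {\<sigma>. \<sigma> permutes {..m}}"
    using image_compose_permutations_left[OF \<rho>] by (simp add: setcompr_eq_image)
  have "min_matching (P \<circ> \<rho>) N m x = min_matching P N m x" for x
  proof -
    have "matching_cost (P \<circ> \<rho>) N m x ` {\<sigma>. \<sigma> permutes {..m}}
        = matching_cost P N m x ` (\<lambda>\<sigma>. \<rho> \<circ> \<sigma>) ` {\<sigma>. \<sigma> permutes {..m}}"
      by (simp add: image_image comp)
    then show ?thesis by (simp add: min_matching_def img)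
  qed
  moreover have "(\<Sum>i\<le>m. min_matching (P \<circ> \<rho>) N m ((P \<circ> \<rho>) i)) \<le> (\<Sum>i=1..m. min_matching (P \<circ> \<rho>) N m (N i))"
  proof (rule sum_min_matching_le_aux)
    fix \<sigma> assume "\<sigma> permutes {..m}"
    then have "\<rho> \<circ> \<sigma> permutes {..m}" by (intro permutes_compose \<rho>)
    then show "(\<Sum>i=1..m. dist (N i) ((P \<circ> \<rho>) i)) \<le> (\<Sum>i=1..m. dist (N i) ((P \<circ> \<rho>) (\<sigma> i)))"
      using min unfolding R_def by fastforce
  qed
  moreover have "(\<Sum>i\<le>m. min_matching P N m (P (\<rho> i))) = (\<Sum>i\<le>m. min_matching P N m (P i))"
    using sum.permute[OF \<rho>, of "\<lambda>i. min_matching P N m (P i)"] by (simp add: o_def)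
  ultimately show ?thesis by simp
qed

subsection \<open>Smooth functions\<close>

text \<open>
  A class of functions closed under directional derivatives, so that its members are smooth without
  any Leibniz or chain rule for higher derivatives.
\<close>

inductive elementary_on :: "'a::euclidean_space set \<Rightarrow> ('a \<Rightarrow> real) \<Rightarrow> bool" for U where
  const: "elementary_on U (\<lambda>x. c)"
| inner: "elementary_on U (\<lambda>x. x \<bullet> v)"
| add: "elementary_on U f \<Longrightarrow> elementary_on U g \<Longrightarrow> elementary_on U (\<lambda>x. f x + g x)"
| mult: "elementary_on U f \<Longrightarrow> elementary_on U g \<Longrightarrow> elementary_on U (\<lambda>x. f x * g x)"
| exp: "elementary_on U f \<Longrightarrow> elementary_on U (\<lambda>x. exp (f x))"
| ln: "elementary_on U f \<Longrightarrow> (\<And>x. x \<in> U \<Longrightarrow> f x > 0) \<Longrightarrow> elementary_on U (\<lambda>x. ln (f x))"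
| powr: "elementary_on U f \<Longrightarrow> (\<And>x. x \<in> U \<Longrightarrow> f x > 0) \<Longrightarrow> elementary_on U (\<lambda>x. f x powr a)"

lemma elementary_on_sum:
  assumes "\<And>i. i \<in> I \<Longrightarrow> elementary_on U (f i)"
  shows "elementary_on U (\<lambda>x. \<Sum>i\<in>I. f i x)"
  using assms by (induction I rule: infinite_finite_induct) (auto intro: elementary_on.intros)

lemma elementary_on_has_derivative:
  assumes "elementary_on U f"
  shows "\<exists>f'. (\<forall>x\<in>U. (f has_derivative f' x) (at x)) \<and> (\<forall>v. elementary_on U (\<lambda>x. f' x v))"
  using assms
proof induction
  case (const c)
  show ?case
    by (rule exI[of _ "\<lambda>x v. 0"]) (auto intro: elementary_on.intros)
next
  case (inner w)
  show ?case
    by (rule exI[of _ "\<lambda>x v. v \<bullet> w"]) (auto intro!: elementary_on.intros derivative_eq_intros)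
next
  case (add f g)
  then obtain f' g' where
    f: "\<And>x. x \<in> U \<Longrightarrow> (f has_derivative f' x) (at x)" "\<And>v. elementary_on U (\<lambda>x. f' x v)" and
    g: "\<And>x. x \<in> U \<Longrightarrow> (g has_derivative g' x) (at x)" "\<And>v. elementary_on U (\<lambda>x. g' x v)"
    by blast
  show ?case
    by (rule exI[of _ "\<lambda>x v. f' x v + g' x v"])
      (auto intro!: elementary_on.intros f g has_derivative_add)
next
  case (mult f g)
  then obtain f' g' where
    f: "\<And>x. x \<in> U \<Longrightarrow> (f has_derivative f' x) (at x)" "\<And>v. elementary_on U (\<lambda>x. f' x v)" and
    g: "\<And>x. x \<in> U \<Longrightarrow> (g has_derivative g' x) (at x)" "\<And>v. elementary_on U (\<lambda>x. g' x v)"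
    by blast
  show ?case
    by (rule exI[of _ "\<lambda>x v. f x * g' x v + f' x v * g x"])
      (auto intro!: elementary_on.intros f g has_derivative_mult mult)
next
  case (exp f)
  then obtain f' where
    f: "\<And>x. x \<in> U \<Longrightarrow> (f has_derivative f' x) (at x)" "\<And>v. elementary_on U (\<lambda>x. f' x v)"
    by blast
  have "((\<lambda>x. exp (f x)) has_derivative (\<lambda>v. exp (f x) * f' x v)) (at x)" if "x \<in> U" for x
    using DERIV_compose_FDERIV[OF DERIV_exp f(1)[OF that]] by (simp add: mult.commute)
  then show ?case
    by (intro exI[of _ "\<lambda>x v. exp (f x) * f' x v"])
      (auto intro!: elementary_on.intros f exp)
next
  case (ln f)
  then obtain f' where
    f: "\<And>x. x \<in> U \<Longrightarrow> (f has_derivative f' x) (at x)" "\<And>v. elementary_on U (\<lambda>x. f' x v)"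
    by blast
  \<comment> \<open>The reciprocal is written as a real power because the class has powers but no
    quotients.\<close>
  have "((\<lambda>x. ln (f x)) has_derivative (\<lambda>v. f' x v * f x powr - 1)) (at x)" if "x \<in> U" for x
    using has_derivative_ln[OF ln(2) f(1), OF that that] ln(2)[OF that] by (simp add: powr_minus)
  then show ?case
    by (intro exI[of _ "\<lambda>x v. f' x v * f x powr - 1"])
      (auto intro!: elementary_on.intros f ln simp del: powr_neg_one')
next
  case (powr f a)
  then obtain f' where
    f: "\<And>x. x \<in> U \<Longrightarrow> (f has_derivative f' x) (at x)" "\<And>v. elementary_on U (\<lambda>x. f' x v)"
    by blast
  have "((\<lambda>x. f x powr a) has_derivative (\<lambda>v. (a * f x powr (a - 1)) * f' x v)) (at x)" if "x \<in> U" for x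
    using DERIV_compose_FDERIV[OF has_real_derivative_powr[OF powr(2)[OF that], of a] f(1)[OF that]]
    by (simp add: mult.commute)
  then show ?case
    by (intro exI[of _ "\<lambda>x v. (a * f x powr (a - 1)) * f' x v"])
      (auto intro!: elementary_on.intros f powr)
qed

text \<open>\<open>frechet_derivative\<close> is a choice among all derivatives at the point, so the
  claim needs only that both functions have the same derivatives there, possibly none.\<close>

lemma frechet_derivative_cong_open:
  assumes "open U" "x \<in> U" "\<And>y. y \<in> U \<Longrightarrow> f y = g y"
  shows "frechet_derivative f (at x) = frechet_derivative g (at x)"
proof -
  have "(f has_derivative D) (at x) \<longleftrightarrow> (g has_derivative D) (at x)" for D
    using has_derivative_transform_within_open[of f D x UNIV U g]
      has_derivative_transform_within_open[of g D x UNIV U f] assms by auto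
  then show ?thesis by (simp add: frechet_derivative_def)
qed

text \<open>Needed because the recursion of \<open>Ck_on\<close> runs through
  \<open>frechet_derivative\<close>, which is known to agree with an explicit derivative only on
  \<open>U\<close>.\<close>

lemma Ck_on_cong:
  fixes f g :: "'a::euclidean_space \<Rightarrow> 'b::real_normed_vector"
  assumes "open U" "\<And>x. x \<in> U \<Longrightarrow> f x = g x"
  shows "Ck_on k U f \<longleftrightarrow> Ck_on k U g"
  using assms(2)
proof (induction k arbitrary: f g)
  case 0
  then show ?case using continuous_on_cong[OF refl, of U f g] by simp
next
  case (Suc k)
  have "f differentiable_on U \<longleftrightarrow> g differentiable_on U"
  proof -
    have "h' differentiable_on U" if "h differentiable_on U" "\<And>x. x \<in> U \<Longrightarrow> h' x = h x" for h h' :: "'a \<Rightarrow> 'b"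
    proof -
      have "(h' has_derivative D) (at x within U)" if "x \<in> U" "(h has_derivative D) (at x within U)" for x D
        using that \<open>\<And>x. x \<in> U \<Longrightarrow> h' x = h x\<close> by (intro has_derivative_transform[of x U h' h])
      then show ?thesis
        using that(1) unfolding differentiable_on_def differentiable_def by blast
    qed
    then show ?thesis using Suc.prems by metis
  qed
  moreover have "\<And>v. Ck_on k U (\<lambda>x. frechet_derivative f (at x) v) \<longleftrightarrow> Ck_on k U (\<lambda>x. frechet_derivative g (at x) v)"
  proof (rule Suc.IH)
    fix v x assume "x \<in> U"
    then show "frechet_derivative f (at x) v = frechet_derivative g (at x) v"
      using frechet_derivative_cong_open[OF assms(1) _ Suc.prems, of x] by simp
  qed
  ultimately show ?case by simp
qed

text \<open>Directional derivatives again have elementary components, so induction on the order with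
  \<open>f\<close> arbitrary closes up. The vector-valued form covers both the radial field and the
  scalar test functions.\<close>

lemma elementary_on_imp_smooth_on:
  fixes f :: "'a::euclidean_space \<Rightarrow> 'b::euclidean_space"
  assumes U: "open U" and f: "\<And>b. b \<in> Basis \<Longrightarrow> elementary_on U (\<lambda>x. f x \<bullet> b)"
  shows "smooth_on U f"
  unfolding smooth_on_def
proof
  fix k
  show "Ck_on k U f"
    using f
  proof (induction k arbitrary: f)
    case (0 f)
    have "continuous_on U (\<lambda>x. f x \<bullet> b)" if b: "b \<in> Basis" for b
    proof -
      obtain f' where "\<And>x. x \<in> U \<Longrightarrow> ((\<lambda>x. f x \<bullet> b) has_derivative f' x) (at x)"
        using elementary_on_has_derivative[OF 0[OF b]] by blast
      then show ?thesis
        by (intro continuous_at_imp_continuous_on ballI has_derivative_continuous)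
    qed
    then show ?case
      unfolding Ck_on.simps using continuous_on_componentwise[of U f] by blast
  next
    case (Suc k f)
    have "\<forall>b\<in>Basis. \<exists>f'. (\<forall>x\<in>U. ((\<lambda>x. f x \<bullet> b) has_derivative f' x) (at x)) \<and>
        (\<forall>v. elementary_on U (\<lambda>x. f' x v))"
      using Suc.prems elementary_on_has_derivative by blast
    from bchoice[OF this] obtain f' where f':
      "\<And>b x. b \<in> Basis \<Longrightarrow> x \<in> U \<Longrightarrow> ((\<lambda>x. f x \<bullet> b) has_derivative f' b x) (at x)"
      "\<And>b v. b \<in> Basis \<Longrightarrow> elementary_on U (\<lambda>x. f' b x v)"
      by blast
    define D where "D = (\<lambda>x v. \<Sum>b\<in>Basis. f' b x v *\<^sub>R b)"
    have D_inner: "D x v \<bullet> b = f' b x v" if "b \<in> Basis" for x v b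
      using that by (simp add: D_def inner_sum_left inner_Basis if_distrib sum.delta cong: if_cong)
    have D: "(f has_derivative D x) (at x)" if "x \<in> U" for x
      by (subst has_derivative_componentwise_within) (auto simp: D_inner f' that)
    have "Ck_on k U (\<lambda>x. D x v)" for v
      by (rule Suc.IH) (simp add: D_inner f')
    moreover have "frechet_derivative f (at x) = D x" if "x \<in> U" for x
      using frechet_derivative_at[OF D[OF that]] by simp
    ultimately have "Ck_on k U (\<lambda>x. frechet_derivative f (at x) v)" for v
      using Ck_on_cong[OF U, of "\<lambda>x. frechet_derivative f (at x) v" "\<lambda>x. D x v"] by simp
    moreover have "f differentiable_on U"
      using D by (auto simp: differentiable_on_def differentiable_def intro: has_derivative_at_withinI)
    ultimately show ?case by simp
  qed
qed

section \<open>Soft minima of distance functions\<close>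

text \<open>The log-sum-exp soft minimum of smoothed distances. Each smoothed distance is
  1-Lipschitz, and the soft minimum is monotone and commutes with adding a constant, so it keeps the
  Lipschitz constant.\<close>

lemma smooth_approx_of_Min_dist:
  fixes q :: "'i \<Rightarrow> 'a::euclidean_space" and c :: "'i \<Rightarrow> real"
  assumes I: "finite I" "I \<noteq> {}" and \<eta>: "\<eta> > 0"
  shows "\<exists>F. smooth_on UNIV F \<and> (\<forall>x y. F x - F y \<le> dist x y) \<and>
    (\<forall>x. \<bar>F x - Min ((\<lambda>i. dist x (q i) + c i) ` I)\<bar> \<le> \<eta>)"
proof -
  define \<epsilon> where "\<epsilon> = \<eta> / 2"
  \<comment> \<open>Makes the soft-minimum error \<open>ln (card I) / k\<close> at most
    \<open>\<eta> / 2\<close>; the summand \<open>1\<close> keeps \<open>k\<close> positive when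
    \<open>I\<close> is a singleton.\<close>
  define k where "k = 2 * (ln (card I) + 1) / \<eta>"
  \<comment> \<open>The norm of the pair is the square root of
    \<open>|x - q i|^2 + \<epsilon>^2\<close>: smooth since \<open>\<epsilon> > 0\<close>, and
    1-Lipschitz by the triangle inequality in the product space.\<close>
  define s where "s = (\<lambda>i x. norm (x - q i, \<epsilon>) + c i)"
  define Z where "Z = (\<lambda>x. \<Sum>i\<in>I. exp (- k * s i x))"
  define F where "F = (\<lambda>x. - (1 / k) * ln (Z x))"
  have card: "card I \<ge> 1" using I by (simp add: Suc_le_eq card_gt_0_iff)
  then have lncard: "ln (card I) \<ge> 0" by simp
  then have k: "k > 0" using \<eta> by (auto simp: k_def)
  have lnk: "ln (card I) / k \<le> \<eta> / 2"
    using \<eta> lncard by (simp add: k_def field_simps)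
  have \<epsilon>: "\<epsilon> > 0" using \<eta> by (simp add: \<epsilon>_def)
  have Zpos: "Z x > 0" for x
    unfolding Z_def using I by (intro sum_pos) auto
  have s_powr: "s i x = ((\<Sum>b\<in>Basis. (x \<bullet> b + - (q i \<bullet> b)) * (x \<bullet> b + - (q i \<bullet> b))) + \<epsilon>\<^sup>2) powr (1/2) + c i" for i x
  proof -
    have "(norm (x - q i))\<^sup>2 = (\<Sum>b\<in>Basis. (x \<bullet> b + - (q i \<bullet> b)) * (x \<bullet> b + - (q i \<bullet> b)))"
      unfolding power2_norm_eq_inner by (subst euclidean_inner) (simp add: inner_diff_left)
    then show ?thesis
      unfolding s_def norm_Pair by (simp add: powr_half_sqrt sum_nonneg)
  qed
  have "elementary_on UNIV (s i)" for i
    unfolding s_powr[abs_def]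
    using \<epsilon> by (intro elementary_on.intros elementary_on_sum) (auto intro!: add_nonneg_pos sum_nonneg)
  then have "elementary_on UNIV Z"
    unfolding Z_def by (intro elementary_on.intros elementary_on_sum)
  then have "elementary_on UNIV F"
    unfolding F_def by (intro elementary_on.intros Zpos)
  then have smooth: "smooth_on UNIV F"
    by (intro elementary_on_imp_smooth_on) auto
  have "F x - F y \<le> dist x y" for x y
  proof -
    have s_le: "s i x \<le> s i y + dist x y" for i
      using norm_triangle_ineq[of "(y - q i, \<epsilon>)" "(x - y, 0::real)"]
      by (simp add: s_def norm_Pair dist_norm)
    \<comment> \<open>Every exponent changes by at most \<open>k * dist x y\<close>, hence the whole
      sum by at most the corresponding factor.\<close>
    have "exp (- k * dist x y) * Z y \<le> Z x"
      unfolding Z_def sum_distrib_left mult_exp_exp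
    proof (intro sum_mono, subst exp_le_cancel_iff)
      fix i
      show "- k * dist x y + - k * s i y \<le> - k * s i x"
        using mult_left_mono[OF s_le[of i], of k] k by (simp add: algebra_simps)
    qed
    then have "ln (exp (- k * dist x y) * Z y) \<le> ln (Z x)"
      using Zpos by (subst ln_le_cancel_iff) auto
    then have "- k * dist x y + ln (Z y) \<le> ln (Z x)"
      using Zpos[of y] by (simp add: ln_mult)
    then show ?thesis
      using k by (simp add: F_def field_simps)
  qed
  moreover have "\<bar>F x - Min ((\<lambda>i. dist x (q i) + c i) ` I)\<bar> \<le> \<eta>" for x
  proof -
    define M where "M = Min ((\<lambda>i. dist x (q i) + c i) ` I)"
    have "M \<in> (\<lambda>i. dist x (q i) + c i) ` I"
      unfolding M_def using I by (intro Min_in) auto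
    then obtain j where j: "j \<in> I" "M = dist x (q j) + c j" by blast
    have lower: "M \<le> s i x" if "i \<in> I" for i
    proof -
      have "M \<le> dist x (q i) + c i"
        unfolding M_def using I that by (intro Min_le) auto
      also have "\<dots> \<le> s i x"
        using norm_fst_le[of "x - q i" \<epsilon>] by (simp add: s_def dist_norm)
      finally show ?thesis .
    qed
    have upper: "s j x \<le> M + \<epsilon>"
      using norm_Pair_le[of "x - q j" \<epsilon>] \<epsilon> by (simp add: s_def j dist_norm)
    \<comment> \<open>Bounding all summands by the largest possible one costs
      \<open>ln (card I) / k\<close> from below; the single summand at the minimizer
      \<open>j\<close> later gives the bound from above.\<close>
    have "Z x \<le> (\<Sum>i\<in>I. exp (- k * M))"
      unfolding Z_def using lower k by (intro sum_mono) simp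
    then have "ln (Z x) \<le> ln (card I * exp (- k * M))"
      using Zpos[of x] card by (subst ln_le_cancel_iff) auto
    also have "\<dots> = ln (card I) - k * M"
      using card by (simp add: ln_mult)
    finally have "ln (Z x) / k \<le> (ln (card I) - k * M) / k"
      using k by (intro divide_right_mono) auto
    then have "M - ln (card I) / k \<le> F x"
      using k by (simp add: F_def diff_divide_distrib)
    moreover have "exp (- k * s j x) \<le> Z x"
      unfolding Z_def using j I by (intro member_le_sum) auto
    then have "ln (exp (- k * s j x)) \<le> ln (Z x)"
      using Zpos[of x] by (subst ln_le_cancel_iff) auto
    then have "F x \<le> s j x"
      using k by (simp add: F_def field_simps)
    ultimately show ?thesis
      using upper lnk \<eta> unfolding M_def[symmetric] \<epsilon>_def by linarith
  qed
  ultimately show ?thesis using smooth by blast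
qed

subsection \<open>Polar coordinates\<close>

lemma nn_integral_lborel_scale:
  fixes f :: "'a::euclidean_space \<Rightarrow> ennreal"
  assumes [measurable]: "f \<in> borel_measurable borel" and c: "c > 0"
  shows "(\<integral>\<^sup>+x. f x \<partial>lborel) = ennreal (c ^ DIM('a)) * (\<integral>\<^sup>+x. f (c *\<^sub>R x) \<partial>lborel)"
  using c by (subst lborel_affine[of c 0])
    (simp_all add: nn_integral_density nn_integral_distr nn_integral_cmult)

lemma nn_integral_inverse_power:
  fixes a :: real
  assumes a: "a > 0" and n: "n > 0"
  shows "(\<integral>\<^sup>+s. ennreal (1 / s ^ Suc n) * indicator {a<..} s \<partial>lborel) = ennreal (1 / (n * a ^ n))"
proof -
  have "(\<integral>\<^sup>+s. ennreal (1 / s ^ Suc n) * indicator {a<..} s \<partial>lborel) =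
      (\<integral>\<^sup>+s. ennreal (1 / s ^ Suc n) * indicator {a..} s \<partial>lborel)"
    using AE_lborel_singleton[of a]
    by (intro nn_integral_cong_AE) (auto split: split_indicator)
  also have "\<dots> = ennreal (0 - (- (inverse a ^ n) / n))"
  proof (rule nn_integral_FTC_atLeast)
    fix s assume "a \<le> s"
    then have s: "s > 0" using a by simp
    obtain m where m: "n = Suc m" using n by (cases n) auto
    show "((\<lambda>s. - (inverse s ^ n) / n) has_real_derivative 1 / s ^ Suc n) (at s)"
    proof -
      have "((\<lambda>s. inverse s ^ n) has_real_derivative real n * (- (inverse s ^ Suc (Suc 0)) * inverse s ^ (n - Suc 0))) (at s)"
        by (rule DERIV_power[OF DERIV_inverse]) (use s in simp)
      then show ?thesis
        by (rule DERIV_cong[OF DERIV_cdivide[OF DERIV_minus]])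
          (use s in \<open>simp add: m divide_inverse power_inverse del: of_nat_Suc\<close>)
    qed
    show "0 \<le> 1 / s ^ Suc n" using s by simp
  next
    have "((\<lambda>s. - (inverse s ^ n) / n) \<longlongrightarrow> - (0 ^ n) / n) at_top"
      using n by (intro tendsto_intros tendsto_inverse_0_at_top filterlim_ident) auto
    then show "((\<lambda>s. - (inverse s ^ n) / real n) \<longlongrightarrow> 0) at_top"
      using n by (simp add: zero_power)
  qed simp
  finally show ?thesis by (simp add: field_simps)
qed

text \<open>
  The density is \<open>|y|\<close> to the power \<open>1 - DIM('a)\<close>, divided by \<open>DIM('a)\<close>; the form below avoids a
  truncated subtraction in the exponent and vanishes at the origin.
\<close>

lemma nn_integral_polar:
  fixes g :: "'a::euclidean_space \<Rightarrow> ennreal"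
  assumes [measurable]: "g \<in> borel_measurable borel"
  shows "(\<integral>\<^sup>+x. \<integral>\<^sup>+t. g ((t / norm x) *\<^sub>R x) * (indicator (ball 0 1) x * indicator {0<..<1} t) \<partial>lborel \<partial>lborel) =
    (\<integral>\<^sup>+y. g y * ennreal (indicator (ball 0 1) y * (norm y / (DIM('a) * norm y ^ DIM('a)))) \<partial>lborel)"
proof -
  \<comment> \<open>\<open>K\<close> arises from substituting \<open>t = |x| s\<close> for fixed
    \<open>x\<close>, and \<open>J\<close> from \<open>y = s x\<close> for fixed \<open>s\<close>.
    The Jacobians are \<open>|x|\<close> and \<open>s\<close> to the power \<open>-DIM('a)\<close>,
    and \<open>|x| < 1\<close> turns into \<open>|y| < s\<close>.\<close>
  define K where "K = (\<lambda>(x::'a) (s::real). if 0 < s \<and> s * norm x < 1 \<and> norm x < 1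
      then ennreal (norm x) * g (s *\<^sub>R x) else 0)"
  define J where "J = (\<lambda>(y::'a) (s::real). if norm y < 1 \<and> norm y < s
      then (g y * ennreal (norm y)) * ennreal (1 / s ^ Suc DIM('a)) else 0)"
  have [measurable]: "case_prod K \<in> borel_measurable (lborel \<Otimes>\<^sub>M lborel)"
    "case_prod J \<in> borel_measurable (lborel \<Otimes>\<^sub>M lborel)"
    unfolding K_def J_def by measurable
  have inner: "(\<integral>\<^sup>+t. g ((t / norm x) *\<^sub>R x) * (indicator (ball 0 1) x * indicator {0<..<1} t) \<partial>lborel) = (\<integral>\<^sup>+s. K x s \<partial>lborel)"
    if "x \<noteq> 0" for x
  proof -
    have "(\<integral>\<^sup>+t. g ((t / norm x) *\<^sub>R x) * (indicator (ball 0 1) x * indicator {0<..<1} t) \<partial>lborel) =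
       (\<integral>\<^sup>+s. ennreal (norm x) * (g (((norm x * s) / norm x) *\<^sub>R x) * (indicator (ball 0 1) x * indicator {0<..<1} (norm x * s))) \<partial>lborel)"
      using that by (subst nn_integral_real_affine[where c = "norm x" and t = 0]) (auto simp: nn_integral_cmult)
    also have "\<dots> = (\<integral>\<^sup>+s. K x s \<partial>lborel)"
      using that by (intro nn_integral_cong) (auto simp: K_def zero_less_mult_iff mult.commute split: split_indicator)
    finally show ?thesis .
  qed
  have scale: "(\<integral>\<^sup>+x. K x s \<partial>lborel) = (\<integral>\<^sup>+y. J y s \<partial>lborel)" for s
  proof (cases "s > 0")
    case True
    have "(\<integral>\<^sup>+x. K x s \<partial>lborel) = (\<integral>\<^sup>+y. ennreal ((1 / s) ^ DIM('a)) * K ((1 / s) *\<^sub>R y) s \<partial>lborel)"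
      using True by (subst nn_integral_lborel_scale[of _ "1 / s"]) (auto simp: nn_integral_cmult)
    also have "\<dots> = (\<integral>\<^sup>+y. J y s \<partial>lborel)"
    proof (rule nn_integral_cong)
      fix y
      have "ennreal ((1 / s) ^ DIM('a)) * (ennreal (norm y / s) * g y) = (g y * ennreal (norm y)) * ennreal (1 / s ^ Suc DIM('a))"
      proof -
        have "ennreal ((1 / s) ^ DIM('a)) * ennreal (norm y / s) = ennreal (norm y) * ennreal (1 / s ^ Suc DIM('a))"
          using True by (simp add: ennreal_mult'[symmetric] power_divide mult.commute)
        then show ?thesis by (metis mult.assoc mult.commute)
      qed
      then show "ennreal ((1 / s) ^ DIM('a)) * K ((1 / s) *\<^sub>R y) s = J y s"
        using True by (auto simp: K_def J_def)
    qed
    finally show ?thesis .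
  next
    case False
    have "J y s = 0" for y
    proof -
      have "\<not> norm y < s" using False norm_ge_zero[of y] by linarith
      then show ?thesis by (simp add: J_def)
    qed
    then show ?thesis using False by (simp add: K_def)
  qed
  \<comment> \<open>For fixed \<open>y\<close> only the power of \<open>s\<close> remains,
    integrated from \<open>|y|\<close> to infinity; this produces the density.\<close>
  have radial: "(\<integral>\<^sup>+s. J y s \<partial>lborel) = g y * ennreal (indicator (ball 0 1) y * (norm y / (DIM('a) * norm y ^ DIM('a))))"
    for y
  proof (cases "y = 0")
    case False
    have "(\<integral>\<^sup>+s. J y s \<partial>lborel) = (\<integral>\<^sup>+s. (g y * ennreal (norm y) * indicator (ball 0 1) y) *
         (ennreal (1 / s ^ Suc DIM('a)) * indicator {norm y<..} s) \<partial>lborel)"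
      by (intro nn_integral_cong) (auto simp: J_def)
    also have "\<dots> = (g y * ennreal (norm y) * indicator (ball 0 1) y) * ennreal (1 / (DIM('a) * norm y ^ DIM('a)))"
      using nn_integral_inverse_power[of "norm y" "DIM('a)"] False
      by (simp add: nn_integral_cmult del: power_Suc)
    also have "\<dots> = g y * ennreal (indicator (ball 0 1) y * (norm y / (DIM('a) * norm y ^ DIM('a))))"
      by (auto simp: mult.assoc ennreal_mult'[symmetric] split: split_indicator)
    finally show ?thesis .
  next
    case True
    then have "J y = (\<lambda>_. 0)"
      by (simp add: J_def fun_eq_iff)
    then show ?thesis using True by simp
  qed
  have "(\<integral>\<^sup>+x. \<integral>\<^sup>+t. g ((t / norm x) *\<^sub>R x) * (indicator (ball 0 1) x * indicator {0<..<1} t) \<partial>lborel \<partial>lborel)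
      = (\<integral>\<^sup>+x. \<integral>\<^sup>+s. K x s \<partial>lborel \<partial>lborel)"
    using AE_lborel_singleton[of 0] by (intro nn_integral_cong_AE) (auto simp: inner)
  also have "\<dots> = (\<integral>\<^sup>+s. \<integral>\<^sup>+x. K x s \<partial>lborel \<partial>lborel)"
    by (rule lborel_pair.Fubini'[symmetric]) measurable
  also have "\<dots> = (\<integral>\<^sup>+s. \<integral>\<^sup>+y. J y s \<partial>lborel \<partial>lborel)"
    by (simp add: scale)
  also have "\<dots> = (\<integral>\<^sup>+y. \<integral>\<^sup>+s. J y s \<partial>lborel \<partial>lborel)"
    by (rule lborel_pair.Fubini') measurable
  also have "\<dots> = (\<integral>\<^sup>+y. g y * ennreal (indicator (ball 0 1) y * (norm y / (DIM('a) * norm y ^ DIM('a)))) \<partial>lborel)"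
    by (simp add: radial)
  finally show ?thesis .
qed

text \<open>The pair \<open>(x, t)\<close> stands for the point at radius \<open>t\<close> in
  direction \<open>x\<close>. Directions come from points of the ball instead of the sphere, in line
  with \<open>sphere_integral\<close>.\<close>

definition polar_measure :: "('a::euclidean_space \<times> real) measure" where
  "polar_measure = density (lborel \<Otimes>\<^sub>M lborel) (\<lambda>(x, t). ennreal (indicator (ball 0 1) x * indicator {0<..<1} t))"

text \<open>\<open>nn_integral_polar\<close> for indicators identifies the image measure; this makes
  the formula available for signed functions.\<close>

lemma distr_polar_measure:
  "distr polar_measure borel (\<lambda>(x, t). (t / norm x) *\<^sub>R x) =
    density lborel (\<lambda>y::'a::euclidean_space. ennreal (indicator (ball 0 1) y * (norm y / (DIM('a) * norm y ^ DIM('a)))))"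
proof (rule measure_eqI)
  fix A :: "'a set" assume "A \<in> sets (distr polar_measure borel (\<lambda>(x, t). (t / norm x) *\<^sub>R x))"
  then have [measurable]: "A \<in> sets borel" by simp
  have [measurable]: "(\<lambda>(x::'a, t::real). (t / norm x) *\<^sub>R x) \<in> borel_measurable (lborel \<Otimes>\<^sub>M lborel)"
    by measurable
  note [measurable] = measurable_compose[OF this borel_measurable_indicator[of A]]
  have [measurable]: "ball 0 1 \<in> sets (borel :: 'a measure)" by simp
  have T: "(\<lambda>(x::'a, t::real). (t / norm x) *\<^sub>R x) \<in> measurable polar_measure borel"
    unfolding polar_measure_def by measurable
  have "emeasure (distr polar_measure borel (\<lambda>(x::'a, t). (t / norm x) *\<^sub>R x)) A
     = (\<integral>\<^sup>+z. indicator A z \<partial>distr polar_measure borel (\<lambda>(x, t). (t / norm x) *\<^sub>R x))"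
    by simp
  also have "\<dots> = (\<integral>\<^sup>+z. indicator A ((\<lambda>(x, t). (t / norm x) *\<^sub>R x) z) \<partial>polar_measure)"
    by (rule nn_integral_distr[OF T]) measurable
  also have "\<dots> = (\<integral>\<^sup>+z. (\<lambda>(x, t). ennreal (indicator (ball 0 1) x * indicator {0<..<1} t)) z *
      indicator A ((\<lambda>(x, t). (t / norm x) *\<^sub>R x) z) \<partial>(lborel \<Otimes>\<^sub>M lborel))"
    unfolding polar_measure_def by (rule nn_integral_density) measurable
  also have "\<dots> = (\<integral>\<^sup>+x. \<integral>\<^sup>+t. indicator A ((t / norm x) *\<^sub>R x) * (indicator (ball 0 1) x * indicator {0<..<1} t) \<partial>lborel \<partial>lborel)"
    by (subst lborel.nn_integral_fst[symmetric])
      (auto intro!: nn_integral_cong split: split_indicator)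
  also have "\<dots> = (\<integral>\<^sup>+y. indicator A y * ennreal (indicator (ball 0 1) y * (norm y / (DIM('a) * norm y ^ DIM('a)))) \<partial>lborel)"
    by (rule nn_integral_polar) measurable
  also have "\<dots> = emeasure (density lborel (\<lambda>y. ennreal (indicator (ball 0 1) y * (norm y / (DIM('a) * norm y ^ DIM('a)))))) A"
    by (simp add: emeasure_density mult.commute)
  finally show "emeasure (distr polar_measure borel (\<lambda>(x, t). (t / norm x) *\<^sub>R x)) A =
    emeasure (density lborel (\<lambda>y. ennreal (indicator (ball 0 1) y * (norm y / (DIM('a) * norm y ^ DIM('a)))))) A" .
qed simp

text \<open>With \<open>g\<close> bounded on the ball, the pulled-back integrand is bounded on a
  product set of finite measure, so Fubini applies.\<close>

lemma integral_polar:
  fixes g :: "'a::euclidean_space \<Rightarrow> real"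
  assumes [measurable]: "g \<in> borel_measurable borel"
    and bound: "\<And>y. y \<in> ball 0 1 \<Longrightarrow> \<bar>g y\<bar> \<le> B"
  shows "integrable lborel (\<lambda>y. (indicator (ball 0 1) y * (norm y / (DIM('a) * norm y ^ DIM('a)))) * g y)"
    and "(\<integral>y. (indicator (ball 0 1) y * (norm y / (DIM('a) * norm y ^ DIM('a)))) * g y \<partial>lborel) =
      (\<integral>x. indicator (ball 0 1) x * (\<integral>t. indicator {0<..<1} t * g ((t / norm x) *\<^sub>R x) \<partial>lborel) \<partial>lborel)"
proof -
  define T where "T = (\<lambda>(x::'a, t::real). (t / norm x) *\<^sub>R x)"
  define W where "W = (\<lambda>(x::'a, t::real). indicat_real (ball 0 1) x * indicat_real {0<..<1} t)"
  have [measurable]: "T \<in> borel_measurable (lborel \<Otimes>\<^sub>M lborel)"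
    unfolding T_def by measurable
  have [measurable]: "W \<in> borel_measurable (lborel \<Otimes>\<^sub>M lborel)"
  proof -
    have [measurable]: "ball 0 1 \<in> sets (borel :: 'a measure)" by simp
    show ?thesis unfolding W_def by measurable
  qed
  have W_nonneg: "0 \<le> W z" for z by (auto simp: W_def split: prod.split)
  have pm: "polar_measure = density (lborel \<Otimes>\<^sub>M lborel) (\<lambda>z. ennreal (W z))"
    unfolding polar_measure_def W_def by (intro arg_cong2[where f = density]) auto
  have T': "T \<in> measurable polar_measure borel"
    unfolding pm by measurable
  have norm_T: "norm (T (x, t)) < 1" if "0 < t" "t < 1" for x t
    using that by (cases "x = 0") (auto simp: T_def)
  have "integrable (lborel \<Otimes>\<^sub>M lborel) (\<lambda>z. indicator (ball 0 1 \<times> {0<..<1}) z *\<^sub>R g (T z))"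
  proof (rule integrableI_bounded_set_indicator[where B = B])
    have "emeasure lborel (ball (0::'a) 1) < \<infinity>"
      using emeasure_bounded_finite[of "ball (0::'a) 1"] by simp
    then show "emeasure (lborel \<Otimes>\<^sub>M lborel) (ball (0::'a) 1 \<times> {0<..<1::real}) < \<infinity>"
      by (simp add: lborel.emeasure_pair_measure_Times)
    show "AE z in lborel \<Otimes>\<^sub>M lborel. z \<in> ball (0::'a) 1 \<times> {0<..<1::real} \<longrightarrow> norm (g (T z)) \<le> B"
      using norm_T by (auto intro!: AE_I2 bound)
    show "ball (0::'a) 1 \<times> {0<..<1::real} \<in> sets (lborel \<Otimes>\<^sub>M lborel)"
      by (intro pair_measureI) auto
    show "(\<lambda>z. g (T z)) \<in> borel_measurable (lborel \<Otimes>\<^sub>M lborel)"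
      by measurable
  qed
  moreover have "indicator (ball 0 1 \<times> {0<..<1}) z *\<^sub>R g (T z) = W z * g (T z)" for z
    by (auto simp: W_def split: prod.split split_indicator)
  ultimately have int: "integrable (lborel \<Otimes>\<^sub>M lborel) (\<lambda>z. W z * g (T z))"
    by (simp only:)
  define w where "w = (\<lambda>y::'a. indicator (ball 0 1) y * (norm y / (DIM('a) * norm y ^ DIM('a))))"
  have distr: "distr polar_measure borel T =
      density lborel (\<lambda>y. ennreal (w y))"
    using distr_polar_measure unfolding T_def w_def .
  have w_nonneg: "0 \<le> w y" for y
    by (simp add: w_def)
  have [measurable]: "w \<in> borel_measurable borel"
    unfolding w_def
    by (intro borel_measurable_times borel_measurable_divide borel_measurable_power
        borel_measurable_indicator borel_measurable_norm borel_measurable_const measurable_ident_sets) auto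
  have "integrable polar_measure (\<lambda>z. g (T z))"
    using int unfolding pm by (subst integrable_real_density) (auto simp: W_nonneg)
  then have "integrable (distr polar_measure borel T) g"
    by (simp add: integrable_distr_eq[OF T'])
  then have "integrable lborel (\<lambda>y. w y * g y)"
    unfolding distr by (subst (asm) integrable_real_density) (auto simp: w_nonneg)
  then show "integrable lborel (\<lambda>y. (indicator (ball 0 1) y * (norm y / (DIM('a) * norm y ^ DIM('a)))) * g y)"
    by (simp only: w_def)
  have "(\<integral>y. w y * g y \<partial>lborel)
      = (\<integral>y. g y \<partial>distr polar_measure borel T)"
    unfolding distr by (subst integral_real_density) (auto simp: w_nonneg)
  also have "\<dots> = (\<integral>z. W z * g (T z) \<partial>(lborel \<Otimes>\<^sub>M lborel))"
    by (subst integral_distr[OF T']) (auto simp: pm integral_real_density W_nonneg)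
  also have "\<dots> = (\<integral>x. (\<integral>t. W (x, t) * g (T (x, t)) \<partial>lborel) \<partial>lborel)"
    using lborel_pair.integral_fst'[OF int] by simp
  also have "\<dots> = (\<integral>x. indicator (ball 0 1) x * (\<integral>t. indicator {0<..<1} t * g ((t / norm x) *\<^sub>R x) \<partial>lborel) \<partial>lborel)"
    by (simp add: W_def T_def mult.assoc)
  finally show "(\<integral>y. (indicator (ball 0 1) y * (norm y / (DIM('a) * norm y ^ DIM('a)))) * g y \<partial>lborel) =
      (\<integral>x. indicator (ball 0 1) x * (\<integral>t. indicator {0<..<1} t * g ((t / norm x) *\<^sub>R x) \<partial>lborel) \<partial>lborel)"
    by (simp only: w_def)
qed

subsection \<open>The radial field\<close>

lemma smooth_on_imp_differentiable_at:
  assumes "smooth_on U f" "open U" "x \<in> U"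
  shows "(f has_derivative frechet_derivative f (at x)) (at x)"
proof -
  have "Ck_on (Suc 0) U f" using assms(1) by (simp only: smooth_on_def)
  then have "f differentiable_on U" by simp
  then show ?thesis
    using assms by (simp add: differentiable_on_eq_differentiable_at frechet_derivative_works)
qed

lemma smooth_on_imp_continuous_on_derivative:
  assumes "smooth_on U f"
  shows "continuous_on U (\<lambda>x. frechet_derivative f (at x) v)"
proof -
  have "Ck_on (Suc 0) U f" using assms(1) by (simp only: smooth_on_def)
  then show ?thesis by simp
qed

lemma inner_grad:
  assumes "(f has_derivative frechet_derivative f (at x)) (at x)"
  shows "v \<bullet> grad f x = frechet_derivative f (at x) v"
proof -
  have lin: "linear (frechet_derivative f (at x))"
    using assms by (rule has_derivative_linear)
  have "frechet_derivative f (at x) v = frechet_derivative f (at x) (\<Sum>i\<in>UNIV. (v $ i) *\<^sub>R axis i 1)"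
    using basis_expansion[of v] by (simp add: scalar_mult_eq_scaleR)
  also have "\<dots> = v \<bullet> grad f x"
    by (simp add: linear_sum[OF lin] linear_scale[OF lin] grad_def inner_vec_def)
  finally show ?thesis by simp
qed

text \<open>The vector \<open>x\<close> divided by the power \<open>DIM('a)\<close> of its norm is
  the unit radial vector times a multiple of the polar density. Along each ray there remains the
  radial derivative of \<open>f\<close>, integrated from the centre to the boundary.\<close>

lemma radial_integral:
  fixes f :: "'a::euclidean_space \<Rightarrow> real"
  assumes U: "open U" "cball 0 1 \<subseteq> U" and f: "smooth_on U f"
  shows "integrable lborel (\<lambda>x. indicator (ball 0 1) x * frechet_derivative f (at x) (x /\<^sub>R norm x ^ DIM('a)))"
    and "(\<integral>x. indicator (ball 0 1) x * frechet_derivative f (at x) (x /\<^sub>R norm x ^ DIM('a)) \<partial>lborel)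
     = DIM('a) * (\<integral>x. indicator (ball 0 1) x * (f (x /\<^sub>R norm x) - f 0) \<partial>lborel)"
proof -
  define D where "D = (\<lambda>x. frechet_derivative f (at x))"
  have D: "(f has_derivative D x) (at x)" if "x \<in> cball 0 1" for x
    using smooth_on_imp_differentiable_at[OF f U(1)] U(2) that by (auto simp: D_def)
  have lin: "linear (D x)" if "x \<in> cball 0 1" for x
    using D[OF that] by (rule has_derivative_linear)
  have contD: "continuous_on (cball 0 1) (\<lambda>x. D x v)" for v
    unfolding D_def using smooth_on_imp_continuous_on_derivative[OF f] U(2) by (rule continuous_on_subset)
  \<comment> \<open>The radial derivative, expanded in components and cut off outside the ball:
    continuity of each \<open>D y b\<close> on the closed ball then yields Borel measurability on
    the whole space.\<close>
  define g where "g = (\<lambda>y. \<Sum>b\<in>Basis. (indicator (ball 0 1) y *\<^sub>R D y b) * ((y /\<^sub>R norm y) \<bullet> b))"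
  have g_eq: "g y = D y (y /\<^sub>R norm y)" if "norm y < 1" for y
  proof -
    have "D y (y /\<^sub>R norm y) = D y (\<Sum>b\<in>Basis. ((y /\<^sub>R norm y) \<bullet> b) *\<^sub>R b)"
      by (simp only: euclidean_representation)
    also have "\<dots> = g y"
      using that lin[of y] by (simp add: g_def linear_sum linear_scale mult.commute)
    finally show ?thesis by simp
  qed
  have [measurable]: "(\<lambda>y. indicator (ball 0 1) y *\<^sub>R D y b) \<in> borel_measurable borel" for b
    by (intro borel_measurable_continuous_on_indicator continuous_on_subset[OF contD]) auto
  have g_meas: "g \<in> borel_measurable borel"
    unfolding g_def by measurable
  have "\<exists>B. \<forall>x\<in>cball 0 1. \<bar>D x b\<bar> \<le> B" for b
    using compact_imp_bounded[OF compact_continuous_image[OF contD compact_cball], of b]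
    by (auto simp: bounded_iff)
  then obtain B where B: "\<And>x b. x \<in> cball 0 1 \<Longrightarrow> \<bar>D x b\<bar> \<le> B b" by metis
  have g_bound: "\<bar>g y\<bar> \<le> (\<Sum>b\<in>Basis. B b)" if "y \<in> ball 0 1" for y
  proof -
    have "\<bar>g y\<bar> \<le> (\<Sum>b\<in>Basis. \<bar>D y b\<bar> * \<bar>(y /\<^sub>R norm y) \<bullet> b\<bar>)"
      unfolding g_def using that by (intro order_trans[OF sum_abs]) (simp add: abs_mult)
    also have "\<dots> \<le> (\<Sum>b\<in>Basis. B b * 1)"
    proof (intro sum_mono mult_mono)
      fix b :: 'a assume b: "b \<in> Basis"
      show "\<bar>D y b\<bar> \<le> B b" using B that by simp
      then show "0 \<le> B b" by linarith
      have "\<bar>(y /\<^sub>R norm y) \<bullet> b\<bar> \<le> norm (y /\<^sub>R norm y)"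
        using b by (rule Basis_le_norm)
      also have "\<dots> \<le> 1" by (cases "y = 0") auto
      finally show "\<bar>(y /\<^sub>R norm y) \<bullet> b\<bar> \<le> 1" .
    qed auto
    finally show ?thesis by simp
  qed
  have FTC: "(\<integral>t. indicator {0<..<1} t * g ((t / norm x) *\<^sub>R x) \<partial>lborel) = f (x /\<^sub>R norm x) - f 0"
    if x: "x \<noteq> 0" for x
  proof -
    define u where "u = x /\<^sub>R norm x"
    have nu: "norm u = 1" using x by (simp add: u_def)
    have tu: "t *\<^sub>R u \<in> cball 0 1" if "0 \<le> t" "t \<le> 1" for t
      using that nu by simp
    \<comment> \<open>At the origin \<open>g\<close> loses the direction \<open>u\<close>, so the
      two integrands are compared off the endpoints only, a null set.\<close>
    have "(\<integral>t. indicator {0<..<1} t * g ((t / norm x) *\<^sub>R x) \<partial>lborel) =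
        (\<integral>t. indicator {0..1} t *\<^sub>R D (t *\<^sub>R u) u \<partial>lborel)"
    proof (rule integral_cong_AE)
      show "(\<lambda>t. indicator {0<..<1} t * g ((t / norm x) *\<^sub>R x)) \<in> borel_measurable lborel"
        using g_meas by measurable
      have "continuous_on {0..1} (\<lambda>t. D (t *\<^sub>R u) u)"
        by (rule continuous_on_compose2[OF contD]) (use tu in \<open>auto intro!: continuous_intros\<close>)
      then show "(\<lambda>t. indicator {0..1} t *\<^sub>R D (t *\<^sub>R u) u) \<in> borel_measurable lborel"
        using borel_measurable_continuous_on_indicator[of "{0..1}" "\<lambda>t. D (t *\<^sub>R u) u"] by simp
      have g_tu: "g ((t / norm x) *\<^sub>R x) = D (t *\<^sub>R u) u" if "0 < t" "t < 1" for t
      proof -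
        have "(t / norm x) *\<^sub>R x = t *\<^sub>R u" by (simp add: u_def divide_inverse)
        then show ?thesis
          using g_eq[of "t *\<^sub>R u"] that nu by simp
      qed
      show "AE t in lborel. indicator {0<..<1} t * g ((t / norm x) *\<^sub>R x) = indicator {0..1} t *\<^sub>R D (t *\<^sub>R u) u"
        using AE_lborel_singleton[of 0] AE_lborel_singleton[of "1::real"]
        by eventually_elim (auto simp: g_tu split: split_indicator)
    qed
    also have "\<dots> = f (1 *\<^sub>R u) - f (0 *\<^sub>R u)"
    proof (rule integral_FTC_atLeastAtMost)
      fix t :: real assume t: "0 \<le> t" "t \<le> 1"
      have "((\<lambda>t. f (t *\<^sub>R u)) has_derivative (\<lambda>s. D (t *\<^sub>R u) (s *\<^sub>R u))) (at t within {0..1})"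
        by (rule has_derivative_compose[where g = f and f = "\<lambda>t. t *\<^sub>R u", OF _ D[OF tu[OF t]]])
          (auto intro!: derivative_eq_intros)
      then show "((\<lambda>t. f (t *\<^sub>R u)) has_vector_derivative D (t *\<^sub>R u) u) (at t within {0..1})"
        using lin[OF tu[OF t]] by (simp add: has_vector_derivative_def linear_scale)
    next
      show "continuous_on {0..1} (\<lambda>t. D (t *\<^sub>R u) u)"
        by (rule continuous_on_compose2[OF contD]) (use tu in \<open>auto intro!: continuous_intros\<close>)
    qed simp
    finally show ?thesis by (simp add: u_def)
  qed
  have density: "indicator (ball 0 1) y * D y (y /\<^sub>R norm y ^ DIM('a)) =
      DIM('a) * ((indicator (ball 0 1) y * (norm y / (DIM('a) * norm y ^ DIM('a)))) * g y)" for y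
  proof -
    \<comment> \<open>At \<open>y = 0\<close> both sides vanish, by linearity of \<open>D 0\<close>
      and by division by zero.\<close>
    have "D y (y /\<^sub>R norm y ^ DIM('a)) = norm y / norm y ^ DIM('a) * g y" if y: "norm y < 1"
    proof (cases "y = 0")
      case False
      have eq: "y /\<^sub>R norm y ^ DIM('a) = (norm y / norm y ^ DIM('a)) *\<^sub>R (y /\<^sub>R norm y)"
        using False by (simp add: divide_inverse)
      show ?thesis
        unfolding eq using lin[of y] y by (subst linear_scale) (simp_all only: g_eq[OF y] mem_cball_0 real_scaleR_def)
    next
      case True
      then show ?thesis using lin[of 0] by (simp add: linear_0)
    qed
    then show "indicator (ball 0 1) y * D y (y /\<^sub>R norm y ^ DIM('a)) =
        DIM('a) * ((indicator (ball 0 1) y * (norm y / (DIM('a) * norm y ^ DIM('a)))) * g y)"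
      by (auto split: split_indicator)
  qed
  have "integrable lborel (\<lambda>x. indicator (ball 0 1) x * D x (x /\<^sub>R norm x ^ DIM('a)))"
    unfolding density
    by (rule integrable_mult_right, rule integral_polar(1)[OF g_meas g_bound])
  then show "integrable lborel (\<lambda>x. indicator (ball 0 1) x * frechet_derivative f (at x) (x /\<^sub>R norm x ^ DIM('a)))"
    by (simp only: D_def)
  have "(\<integral>x. indicator (ball 0 1) x * D x (x /\<^sub>R norm x ^ DIM('a)) \<partial>lborel) =
     (\<integral>y. DIM('a) * ((indicator (ball 0 1) y * (norm y / (DIM('a) * norm y ^ DIM('a)))) * g y) \<partial>lborel)"
    by (simp only: density)
  also have "\<dots> = DIM('a) * (\<integral>x. indicator (ball 0 1) x * (\<integral>t. indicator {0<..<1} t * g ((t / norm x) *\<^sub>R x) \<partial>lborel) \<partial>lborel)"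
    by (simp only: integral_mult_right_zero integral_polar(2)[OF g_meas g_bound])
  also have "(\<integral>x. indicator (ball 0 1) x * (\<integral>t. indicator {0<..<1} t * g ((t / norm x) *\<^sub>R x) \<partial>lborel) \<partial>lborel) =
      (\<integral>x. indicator (ball 0 1) x * (f (x /\<^sub>R norm x) - f 0) \<partial>lborel)"
  proof (rule integral_cong_AE)
    \<comment> \<open>Continuity of \<open>f\<close> is used only on the closed ball, where
      \<open>x /\<^sub>R norm x\<close> always lies, with value \<open>0\<close> at the origin;
      hence the cutoff does no harm.\<close>
    have [measurable]: "(\<lambda>y. indicator (cball 0 1) y *\<^sub>R f y) \<in> borel_measurable borel"
    proof (intro borel_measurable_continuous_on_indicator continuous_at_imp_continuous_on ballI)
      fix x :: 'a assume "x \<in> cball 0 1"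
      then show "isCont f x" by (rule has_derivative_continuous[OF D])
    qed simp
    have unit: "x /\<^sub>R norm x \<in> cball 0 1" for x :: 'a
      by (cases "x = 0") auto
    have "(\<lambda>x. indicator (cball 0 1) (x /\<^sub>R norm x) *\<^sub>R f (x /\<^sub>R norm x)) \<in> borel_measurable borel"
      by measurable
    then have [measurable]: "(\<lambda>x. f (x /\<^sub>R norm x)) \<in> borel_measurable borel"
      using unit by simp
    have [measurable]: "ball 0 1 \<in> sets (borel :: 'a measure)" by simp
    show "(\<lambda>x. indicator (ball 0 1) x * (f (x /\<^sub>R norm x) - f 0)) \<in> borel_measurable lborel"
      by measurable
    show "(\<lambda>x. indicator (ball 0 1) x * (\<integral>t. indicator {0<..<1} t * g ((t / norm x) *\<^sub>R x) \<partial>lborel)) \<in> borel_measurable lborel"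
      using g_meas by measurable
    show "AE x in lborel. indicator (ball 0 1) x * (\<integral>t. indicator {0<..<1} t * g ((t / norm x) *\<^sub>R x) \<partial>lborel) =
        indicator (ball 0 1) x * (f (x /\<^sub>R norm x) - f 0)"
      using AE_lborel_singleton[of 0] by eventually_elim (simp add: FTC)
  qed
  finally show "(\<integral>x. indicator (ball 0 1) x * frechet_derivative f (at x) (x /\<^sub>R norm x ^ DIM('a)) \<partial>lborel)
     = DIM('a) * (\<integral>x. indicator (ball 0 1) x * (f (x /\<^sub>R norm x) - f 0) \<partial>lborel)"
    by (simp add: D_def)
qed

section \<open>Spherical integrals; mass and flux of the radial field\<close>

text \<open>Passes from the completed measure to \<open>lborel\<close>, in which the polar
  coordinate formulas are stated.\<close>

lemma sphere_integral_lborel: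
  assumes "continuous_on (cball 0 1) f"
  shows "integrable lborel (\<lambda>x. indicator (ball 0 1) x * f (x /\<^sub>R norm x))"
    and "sphere_integral f = 5 * (\<integral>x. indicator (ball 0 1) x * f (x /\<^sub>R norm x) \<partial>lborel)"
proof -
  have unit: "x /\<^sub>R norm x \<in> cball 0 1" for x :: "real^5"
    by (cases "x = 0") auto
  have [measurable]: "(\<lambda>y. indicator (cball 0 1) y *\<^sub>R f y) \<in> borel_measurable borel"
    using assms by (intro borel_measurable_continuous_on_indicator) auto
  have "(\<lambda>x. indicator (cball 0 1) (x /\<^sub>R norm x) *\<^sub>R f (x /\<^sub>R norm x)) \<in> borel_measurable borel"
    by measurable
  then have meas [measurable]: "(\<lambda>x. f (x /\<^sub>R norm x)) \<in> borel_measurable borel"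
    using unit by simp
  obtain B where "\<forall>y\<in>f ` cball 0 1. norm y \<le> B"
    using compact_imp_bounded[OF compact_continuous_image[OF assms compact_cball]]
    unfolding bounded_iff by blast
  then have B: "norm (f y) \<le> B" if "y \<in> cball 0 1" for y
    using that by blast
  have "integrable lborel (\<lambda>x. indicator (ball 0 1) x *\<^sub>R f (x /\<^sub>R norm x))"
    using emeasure_bounded_finite[of "ball (0::real^5) 1"] B unit
    by (intro integrableI_bounded_set_indicator[where B = B]) auto
  then show int: "integrable lborel (\<lambda>x. indicator (ball 0 1) x * f (x /\<^sub>R norm x))"
    by simp
  show "sphere_integral f = 5 * (\<integral>x. indicator (ball 0 1) x * f (x /\<^sub>R norm x) \<partial>lborel)"
    unfolding sphere_integral_def set_lebesgue_integral_def
    using borel_measurable_integrable[OF int] by (simp add: integral_completion)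
qed

lemma S4_area_eq: "S4_area = 5 * measure lborel (ball (0::real^5) 1)"
  unfolding S4_area_def by (subst sphere_integral_lborel(2)) auto

lemma S4_area_pos: "S4_area > 0"
  by (simp add: S4_area_eq content_ball_pos)

lemma Xrad_measurable [measurable]: "Xrad \<in> borel_measurable borel"
  unfolding Xrad_def[abs_def]
  by (intro borel_measurable_scaleR borel_measurable_const borel_measurable_inverse
      borel_measurable_power borel_measurable_norm) simp_all

text \<open>Arranged as a multiple of the polar density in dimension 5; at the origin both sides are
  zero.\<close>

lemma norm_Xrad: "norm (Xrad x) = 5 / S4_area * (norm x / (5 * norm x ^ 5))"
proof -
  have "norm (Xrad x) = 1 / S4_area * (inverse (norm x ^ 5) * norm x)"
    unfolding Xrad_def norm_scaleR using S4_area_pos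
    by (simp only: abs_inverse power_abs abs_norm_cancel abs_divide abs_one abs_of_pos)
  then show ?thesis
    by (simp only: divide_inverse inverse_mult_distrib) simp
qed

text \<open>The polar density integrates to the volume of the ball, by \<open>integral_polar\<close>
  for the constant \<open>1\<close>, and \<open>5 / S4_area\<close> is the reciprocal of that
  volume.\<close>

lemma
  shows set_integrable_Xrad: "set_integrable lebesgue (ball 0 1) Xrad"
    and integral_norm_Xrad: "(LINT x : ball 0 1 | lebesgue. norm (Xrad x)) = 1"
proof -
  define w where "w = (\<lambda>y::real^5. (indicator (ball 0 1) y * (norm y / (5 * norm y ^ 5))) * (1::real))"
  have dim: "DIM(real^5) = 5" by simp
  have w: "integrable lborel w" "(\<integral>y. w y \<partial>lborel) = measure lborel (ball (0::real^5) 1)"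
    using integral_polar[of "\<lambda>_::real^5. 1::real" 1] unfolding w_def dim by simp_all
  have norm_w: "norm (indicator (ball 0 1) x *\<^sub>R Xrad x) = 5 / S4_area * w x" for x
    unfolding w_def norm_scaleR norm_Xrad
    by (cases "x \<in> ball 0 1") (simp_all only: indicator_simps abs_one abs_zero
        mult_1_left mult_1_right mult_zero_left mult_zero_right simp_thms)
  have ball [measurable]: "ball (0::real^5) 1 \<in> sets borel" by simp
  have m: "(\<lambda>x. indicator (ball 0 1) x *\<^sub>R Xrad x) \<in> borel_measurable lborel"
    by measurable
  have int: "integrable lborel (\<lambda>x. indicator (ball 0 1) x *\<^sub>R Xrad x)"
    using m w(1) by (subst integrable_norm_iff[symmetric]) (simp_all only: norm_w integrable_mult_right)
  then show "set_integrable lebesgue (ball 0 1) Xrad"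
    unfolding set_integrable_def using m by (simp add: integrable_completion)
  have "(LINT x : ball 0 1 | lebesgue. norm (Xrad x)) = (\<integral>x. norm (indicator (ball 0 1) x *\<^sub>R Xrad x) \<partial>lebesgue)"
    unfolding set_lebesgue_integral_def by (intro Bochner_Integration.integral_cong) auto
  also have "\<dots> = (\<integral>x. norm (indicator (ball 0 1) x *\<^sub>R Xrad x) \<partial>lborel)"
    using m by (intro integral_completion) measurable
  also have "\<dots> = 1"
    using S4_area_pos by (simp only: norm_w) (simp add: w S4_area_eq)
  finally show "(LINT x : ball 0 1 | lebesgue. norm (Xrad x)) = 1" .
qed

lemma smooth_on_Xrad: "smooth_on (ball 0 1 - {0}) Xrad"
proof (rule elementary_on_imp_smooth_on)
  fix b :: "real^5" assume "b \<in> Basis"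
  \<comment> \<open>The inverse fifth power of the norm becomes a real power of the sum of squares,
    whose base is positive off the origin, so the component is elementary there.\<close>
  have "Xrad x \<bullet> b = (1 / S4_area) * ((\<Sum>c\<in>Basis. (x \<bullet> c) * (x \<bullet> c)) powr (- 5 / 2) * (x \<bullet> b))" for x
  proof -
    have "inverse (norm x ^ 5) = (x \<bullet> x) powr (- 5 / 2)"
    proof (cases "x = 0")
      case False
      have "(x \<bullet> x) powr (- 5 / 2) = (norm x powr 2) powr (- 5 / 2)"
        using False by (simp add: dot_square_norm)
      also have "\<dots> = norm x powr (- 5)"
        by (simp only: powr_powr) simp
      also have "\<dots> = inverse (norm x powr 5)"
        by (rule powr_minus)
      also have "\<dots> = inverse (norm x ^ 5)"
        using False by simp
      finally show ?thesis by simp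
    qed simp
    moreover have "x \<bullet> x = (\<Sum>c\<in>Basis. (x \<bullet> c) * (x \<bullet> c))"
      by (rule euclidean_inner)
    ultimately show ?thesis by (simp add: Xrad_def)
  qed
  moreover have "(\<Sum>c\<in>Basis. (x \<bullet> c) * (x \<bullet> c)) > 0" if "x \<in> ball 0 1 - {0}" for x :: "real^5"
    using that euclidean_inner[of x x] inner_gt_zero_iff[of x] by simp
  ultimately show "elementary_on (ball 0 1 - {0}) (\<lambda>x. Xrad x \<bullet> b)"
    by (simp only:) (intro elementary_on.intros elementary_on_sum)
qed auto

text \<open>\<open>radial_integral\<close> in dimension 5. The term \<open>f 0\<close> gets the
  coefficient \<open>5 * measure lborel (ball 0 1) / S4_area = 1\<close>, so the origin carries
  degree one.\<close>

lemma Xrad_flux: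
  assumes U: "open U" "cball 0 1 \<subseteq> U" and f: "smooth_on U f"
  shows "(LINT x : ball 0 1 | lebesgue. Xrad x \<bullet> grad f x) = - f 0 + sphere_integral f / S4_area"
proof -
  define h where "h = (\<lambda>x. indicator (ball 0 1) x * frechet_derivative f (at x) (x /\<^sub>R norm x ^ DIM(real^5)))"
  have h: "integrable lborel h"
    "(\<integral>x. h x \<partial>lborel) = 5 * (\<integral>x. indicator (ball 0 1) x * (f (x /\<^sub>R norm x) - f 0) \<partial>lborel)"
    using radial_integral[OF U f] by (simp_all add: h_def)
  have [measurable]: "h \<in> borel_measurable borel"
    using borel_measurable_integrable[OF h(1)] by simp
  have der: "(f has_derivative frechet_derivative f (at x)) (at x)" if "x \<in> cball 0 1" for x
    using smooth_on_imp_differentiable_at[OF f U(1)] U(2) that by auto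
  have cont: "continuous_on (cball 0 1) f"
    using der by (intro continuous_at_imp_continuous_on ballI has_derivative_continuous)
  have "Xrad x \<bullet> grad f x = 1 / S4_area * frechet_derivative f (at x) (x /\<^sub>R norm x ^ 5)" if "x \<in> ball 0 1" for x
    using inner_grad[OF der, of x "Xrad x"] linear_scale[OF has_derivative_linear[OF der, of x]] that
    unfolding Xrad_def by auto
  then have "(LINT x : ball 0 1 | lebesgue. Xrad x \<bullet> grad f x) = (\<integral>x. 1 / S4_area * h x \<partial>lebesgue)"
    unfolding set_lebesgue_integral_def
    by (intro Bochner_Integration.integral_cong) (auto simp: h_def split: split_indicator)
  also have "\<dots> = (\<integral>x. 1 / S4_area * h x \<partial>lborel)"
    by (intro integral_completion) measurable
  also have "\<dots> = 1 / S4_area * (5 * (\<integral>x. indicator (ball 0 1) x * f (x /\<^sub>R norm x) - indicator (ball 0 1) x * f 0 \<partial>lborel))"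
    by (simp add: h right_diff_distrib)
  also have "\<dots> = 1 / S4_area * (sphere_integral f - S4_area * f 0)"
  proof -
    have "integrable lborel (\<lambda>x::real^5. indicator (ball 0 1) x * f 0)"
      using emeasure_bounded_finite[of "ball (0::real^5) 1"]
      by (intro integrable_mult_left integrable_real_indicator) auto
    then show ?thesis
      using sphere_integral_lborel[OF cont]
      by (simp add: Bochner_Integration.integral_diff S4_area_eq algebra_simps)
  qed
  also have "\<dots> = - f 0 + sphere_integral f / S4_area"
    using S4_area_pos by (simp add: field_simps)
  finally show ?thesis .
qed

lemma admissible_Xrad: "admissible Xrad"
proof -
  have "(LINT x : ball 0 1 | lebesgue. Xrad x \<bullet> grad f x) =
      - (\<Sum>p\<in>{0}. of_int 1 * f p) + sphere_integral f / S4_area"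
    if "open U" "cball 0 1 \<subseteq> U" "smooth_on U f" for f U
    using Xrad_flux[OF that] by simp
  then show ?thesis
    unfolding admissible_def using set_integrable_Xrad smooth_on_Xrad
    by (intro conjI exI[of _ "{0}"] exI[of _ "\<lambda>_. 1"]) auto
qed

subsection \<open>The lower bound\<close>

lemma lipschitz_derivative_le:
  fixes F :: "'a::real_normed_vector \<Rightarrow> real"
  assumes lip: "\<And>x y. F x - F y \<le> dist x y" and F: "(F has_derivative F') (at x)"
  shows "F' v \<le> norm v"
proof -
  have "((\<lambda>t. F (x + t *\<^sub>R v)) has_derivative (\<lambda>t. F' (t *\<^sub>R v))) (at 0)"
    by (rule has_derivative_compose[where g = F and f = "\<lambda>t. x + t *\<^sub>R v"])
      (use F in \<open>auto intro!: derivative_eq_intros\<close>)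
  then have "((\<lambda>t. F (x + t *\<^sub>R v)) has_real_derivative F' v) (at 0)"
    using linear_scale[OF has_derivative_linear[OF F]]
    by (simp add: has_field_derivative_def mult_commute_abs)
  then have "((\<lambda>t. (F (x + t *\<^sub>R v) - F x) / t) \<longlongrightarrow> F' v) (at 0)"
    by (simp add: has_field_derivative_iff)
  \<comment> \<open>For positive \<open>t\<close> the Lipschitz bound can be divided by
    \<open>t\<close> without a change of sign.\<close>
  then have "((\<lambda>t. (F (x + t *\<^sub>R v) - F x) / t) \<longlongrightarrow> F' v) (at_right 0)"
    by (rule tendsto_mono[rotated]) (simp add: at_within_le_at)
  then show ?thesis
  proof (rule tendsto_upperbound)
    show "\<forall>\<^sub>F t in at_right 0. (F (x + t *\<^sub>R v) - F x) / t \<le> norm v"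
      unfolding eventually_at_right_field
    proof (intro exI[of _ 1] conjI allI impI)
      fix t :: real assume "0 < t" "t < 1"
      then show "(F (x + t *\<^sub>R v) - F x) / t \<le> norm v"
        using lip[of "x + t *\<^sub>R v" x] by (simp add: dist_norm divide_le_eq mult.commute)
    qed simp
  qed simp
qed

lemma integral_lborel_uminus:
  fixes h :: "'a::euclidean_space \<Rightarrow> real"
  assumes [measurable]: "h \<in> borel_measurable borel"
  shows "(\<integral>x. h x \<partial>lborel) = (\<integral>x. h (- x) \<partial>lborel)"
  by (subst lborel_affine[of "-1" 0]) (simp_all add: integral_distr density_1)

text \<open>Antipodal symmetrization: the ball and Lebesgue measure are invariant under negation, so
  averaging \<open>F u + F (- u)\<close> gives twice the average of \<open>F\<close>.\<close>

lemma sphere_integral_lower_bound: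
  assumes F: "continuous_on (cball 0 1) F"
    and c: "\<And>u. norm u = 1 \<Longrightarrow> 2 * c \<le> F u + F (- u)"
  shows "c * S4_area \<le> sphere_integral F"
proof -
  define h where "h = (\<lambda>x. indicator (ball 0 1) x * F (x /\<^sub>R norm x))"
  have h: "integrable lborel h" "sphere_integral F = 5 * (\<integral>x. h x \<partial>lborel)"
    using sphere_integral_lborel[OF F] by (simp_all add: h_def)
  have [measurable]: "h \<in> borel_measurable borel"
    using borel_measurable_integrable[OF h(1)] by simp
  have h': "integrable lborel (\<lambda>x. h (- x))"
  proof -
    have "h (- x) = indicator (ball 0 1) x * (\<lambda>y. F (- y)) (x /\<^sub>R norm x)" for x
      by (simp add: h_def indicator_def)
    moreover have "continuous_on (cball 0 1) (\<lambda>y. F (- y))"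
      by (rule continuous_on_compose2[OF F]) (auto intro!: continuous_intros)
    ultimately show ?thesis using sphere_integral_lborel(1)[of "\<lambda>y. F (- y)"] by simp
  qed
  have "2 * c * measure lborel (ball (0::real^5) 1) = (\<integral>x. 2 * c * indicator (ball (0::real^5) 1) x \<partial>lborel)"
    by simp
  also have "\<dots> \<le> (\<integral>x. h x + h (- x) \<partial>lborel)"
  proof (rule integral_mono_AE)
    show "integrable lborel (\<lambda>x. 2 * c * indicator (ball (0::real^5) 1) x)"
      using emeasure_bounded_finite[of "ball (0::real^5) 1"]
      by (intro integrable_mult_right integrable_real_indicator) auto
    show "integrable lborel (\<lambda>x. h x + h (- x))"
      using h(1) h' by (rule Bochner_Integration.integrable_add)
    have pointwise: "2 * c * indicator (ball 0 1) x \<le> h x + h (- x)" if "x \<noteq> 0" for x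
      using c[of "x /\<^sub>R norm x"] that by (simp add: h_def indicator_def)
    show "AE x in lborel. 2 * c * indicator (ball 0 1) x \<le> h x + h (- x)"
      using AE_lborel_singleton[of 0] by eventually_elim (rule pointwise)
  qed
  also have "\<dots> = 2 * (\<integral>x. h x \<partial>lborel)"
    using h(1) h' integral_lborel_uminus[of h] by simp
  finally show ?thesis
    by (simp add: h S4_area_eq)
qed

section \<open>Point charges of an admissible field and the final estimate\<close>

text \<open>A charge \<open>d p\<close> becomes that many copies of \<open>p\<close> in the list of
  its sign; truncation by \<open>nat\<close> leaves the other list unchanged. The lists are
  independent of \<open>g\<close>.\<close>

lemma int_combination_as_lists:
  fixes d :: "'a \<Rightarrow> int"
  assumes "finite S"
  shows "\<exists>ps ns. \<forall>g::'a \<Rightarrow> real. (\<Sum>p\<in>S. of_int (d p) * g p) = sum_list (map g ps) - sum_list (map g ns)"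
  using assms
proof induction
  case empty
  show ?case by (intro exI[of _ "[]"]) simp
next
  case (insert p S)
  then obtain ps ns where *: "\<forall>g::'a \<Rightarrow> real. (\<Sum>p\<in>S. of_int (d p) * g p) = sum_list (map g ps) - sum_list (map g ns)"
    by (elim exE) (rule that)
  have "(\<Sum>p\<in>insert p S. of_int (d p) * g p) =
      sum_list (map g (replicate (nat (d p)) p @ ps)) - sum_list (map g (replicate (nat (- d p)) p @ ns))" for g :: "'a \<Rightarrow> real"
  proof -
    have "of_int (d p) * g p = real (nat (d p)) * g p - real (nat (- d p)) * g p"
      by (cases "d p \<ge> 0") auto
    then show ?thesis
      using insert(1,2) *[rule_format, of g] by (simp add: sum_list_replicate)
  qed
  then show ?case by blast
qed

lemma test_function_lower_bound:
  assumes X: "set_integrable lebesgue (ball 0 1) X"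
    and F: "smooth_on UNIV F" "\<And>x y. F x - F y \<le> dist x y"
  shows "(LINT x : ball 0 1 | lebesgue. X x \<bullet> grad F x) \<le> (LINT x : ball 0 1 | lebesgue. norm (X x))"
  unfolding set_lebesgue_integral_def
\<comment> \<open>This rule asks for integrability of \<open>norm (X x)\<close> alone: a
  non-integrable left side has integral \<open>0\<close>, which the nonnegative right side
  dominates.\<close>
proof (rule integral_mono')
  show "integrable lebesgue (\<lambda>x. indicator (ball 0 1) x *\<^sub>R norm (X x))"
    using set_integrable_norm[OF X] by (simp add: set_integrable_def)
  fix x
  have "(F has_derivative frechet_derivative F (at x)) (at x)"
    using smooth_on_imp_differentiable_at[OF F(1)] by simp
  then have "X x \<bullet> grad F x \<le> norm (X x)"
    using lipschitz_derivative_le[OF F(2)] by (simp add: inner_grad)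
  then show "indicator (ball 0 1) x *\<^sub>R (X x \<bullet> grad F x) \<le> indicator (ball 0 1) x *\<^sub>R norm (X x)"
    by (simp split: split_indicator)
  show "0 \<le> indicator (ball 0 1) x *\<^sub>R norm (X x)" by simp
qed

lemma admissible_degrees:
  assumes "admissible X"
  shows "\<exists>(P :: nat \<Rightarrow> real^5) N m. \<forall>f U. open U \<and> cball 0 1 \<subseteq> U \<and> smooth_on U f \<longrightarrow>
      (LINT x : ball 0 1 | lebesgue. X x \<bullet> grad f x) =
        (\<Sum>i=1..m. f (N i)) - (\<Sum>i\<le>m. f (P i)) + sphere_integral f / S4_area"
proof -
  from assms[unfolded admissible_def] obtain S and d :: "real^5 \<Rightarrow> int" where fin: "finite S"
    and flux': "\<forall>f U. open U \<and> cball 0 1 \<subseteq> U \<and> smooth_on U f \<longrightarrow>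
      (LINT x : ball 0 1 | lebesgue. X x \<bullet> grad f x) =
        - (\<Sum>p\<in>S. of_int (d p) * f p) + sphere_integral f / S4_area"
    by (elim conjE exE) (rule that)
  have flux: "(LINT x : ball 0 1 | lebesgue. X x \<bullet> grad f x) =
        - (\<Sum>p\<in>S. of_int (d p) * f p) + sphere_integral f / S4_area"
    if "open U" "cball 0 1 \<subseteq> U" "smooth_on U f" for f U
    using flux'[rule_format, of U f] that by simp
  obtain ps ns where
    lists: "\<forall>g::_ \<Rightarrow> real. (\<Sum>p\<in>S. of_int (d p) * g p) = sum_list (map g ps) - sum_list (map g ns)"
    using int_combination_as_lists[OF fin, of d] by (elim exE) (rule that)
  have "smooth_on UNIV (\<lambda>_::real^5. 1::real)"
    by (intro elementary_on_imp_smooth_on open_UNIV elementary_on.const)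
  moreover have "grad (\<lambda>_. 1) x = 0" for x
    by (simp add: grad_def vec_eq_iff)
  ultimately have "(\<Sum>p\<in>S. of_int (d p) * 1) = (1::real)"
    using flux[of UNIV "\<lambda>_. 1"] S4_area_pos by (simp add: S4_area_def)
  then have "real (length ps) = real (length ns) + 1"
    using lists[rule_format, of "\<lambda>_. 1"] by (simp add: sum_list_triv)
  then have len: "length ps = Suc (length ns)" by linarith
  show ?thesis
  proof (intro exI allI impI)
    fix f :: "real^5 \<Rightarrow> real" and U assume "open U \<and> cball 0 1 \<subseteq> U \<and> smooth_on U f"
    \<comment> \<open>Positive charges are numbered from \<open>0\<close> and negative ones from
      \<open>1\<close>, hence the shifted index into \<open>ns\<close>; this leaves slot
      \<open>0\<close> for the extra negative charge.\<close>
    then show "(LINT x : ball 0 1 | lebesgue. X x \<bullet> grad f x) =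
        (\<Sum>i=1..length ns. f (ns ! (i - 1))) - (\<Sum>i\<le>length ns. f (ps ! i)) + sphere_integral f / S4_area"
      using flux[of U f] lists[rule_format, of f]
      by (simp add: sum_list_sum_nth len atLeast0LessThan sum.atLeast1_atMost_eq lessThan_Suc_atMost)
  qed
qed

lemma admissible_norm_ge_1:
  assumes X: "admissible X"
  shows "1 \<le> (LINT x : ball 0 1 | lebesgue. norm (X x))"
proof -
  obtain P N :: "nat \<Rightarrow> real^5" and m where
    flux: "\<forall>f U. open U \<and> cball 0 1 \<subseteq> U \<and> smooth_on U f \<longrightarrow>
      (LINT x : ball 0 1 | lebesgue. X x \<bullet> grad f x) =
        (\<Sum>i=1..m. f (N i)) - (\<Sum>i\<le>m. f (P i)) + sphere_integral f / S4_area"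
    using admissible_degrees[OF X] by (elim exE) (rule that)
  define C where "C = min_matching P N m"
  \<comment> \<open>Replacing \<open>C\<close> by its approximation costs \<open>\<eta>\<close> at
    each of the \<open>m\<close> negative and \<open>m + 1\<close> positive charges, and once more
    in the mean over the sphere.\<close>
  have lower: "1 - real (2 * m + 2) * \<eta> \<le> (LINT x : ball 0 1 | lebesgue. norm (X x))" if \<eta>: "\<eta> > 0" for \<eta>
  proof -
    have ne: "{\<sigma>. \<sigma> permutes {..m}} \<noteq> {}" using permutes_id by blast
    obtain F where F: "smooth_on UNIV F" "\<forall>x y. F x - F y \<le> dist x y"
      and "\<forall>x. \<bar>F x - Min ((\<lambda>\<sigma>. dist x (P (\<sigma> 0)) + (\<Sum>i=1..m. dist (N i) (P (\<sigma> i)))) ` {\<sigma>. \<sigma> permutes {..m}})\<bar> \<le> \<eta>"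
      using smooth_approx_of_Min_dist[OF finite_permutations_atMost[of m] ne \<eta>,
          of "\<lambda>\<sigma>. P (\<sigma> 0)" "\<lambda>\<sigma>. \<Sum>i=1..m. dist (N i) (P (\<sigma> i))"]
      by (elim exE conjE) (rule that)
    then have F_C: "\<bar>F x - C x\<bar> \<le> \<eta>" for x
      unfolding C_def min_matching_def matching_cost_def[abs_def] by simp
    have low: "C x - \<eta> \<le> F x" and up: "F x \<le> C x + \<eta>" for x
      using F_C[of x] by linarith+
    have "(\<Sum>i=1..m. C (N i)) - m * \<eta> = (\<Sum>i=1..m. C (N i) - \<eta>)"
      by (simp add: sum_subtractf)
    also have "\<dots> \<le> (\<Sum>i=1..m. F (N i))"
      by (intro sum_mono low)
    finally have A: "(\<Sum>i=1..m. C (N i)) - m * \<eta> \<le> (\<Sum>i=1..m. F (N i))" .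
    have "(\<Sum>i\<le>m. F (P i)) \<le> (\<Sum>i\<le>m. C (P i) + \<eta>)"
      by (intro sum_mono up)
    also have "\<dots> = (\<Sum>i\<le>m. C (P i)) + (m + 1) * \<eta>"
      by (simp add: sum.distrib)
    finally have B: "(\<Sum>i\<le>m. F (P i)) \<le> (\<Sum>i\<le>m. C (P i)) + (m + 1) * \<eta>" .
    have "(1 - \<eta>) * S4_area \<le> sphere_integral F"
    proof (rule sphere_integral_lower_bound)
      show "continuous_on (cball 0 1) F"
        using smooth_on_imp_differentiable_at[OF F(1)]
        by (intro continuous_at_imp_continuous_on ballI has_derivative_continuous) auto
      fix u :: "real^5" assume u: "norm u = 1"
      have "dist u (- u) = norm (2 *\<^sub>R u)"
        by (simp add: dist_norm scaleR_2)
      then have "2 \<le> C u + C (- u)"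
        using min_matching_add_ge_dist[of u "- u" P N m] u by (simp add: C_def)
      then show "2 * (1 - \<eta>) \<le> F u + F (- u)"
        using low[of u] low[of "- u"] by simp
    qed
    then have D: "1 - \<eta> \<le> sphere_integral F / S4_area"
      using S4_area_pos by (simp add: pos_le_divide_eq)
    have "(\<Sum>i\<le>m. C (P i)) \<le> (\<Sum>i=1..m. C (N i))"
      unfolding C_def by (rule sum_min_matching_le)
    with A B D have "1 - real (2 * m + 2) * \<eta> \<le> (\<Sum>i=1..m. F (N i)) - (\<Sum>i\<le>m. F (P i)) + sphere_integral F / S4_area"
      by (simp add: algebra_simps)
    also have "\<dots> = (LINT x : ball 0 1 | lebesgue. X x \<bullet> grad F x)"
      using flux[rule_format, of UNIV F] F(1) by simp
    also have "\<dots> \<le> (LINT x : ball 0 1 | lebesgue. norm (X x))"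
      using X F(1,2) by (intro test_function_lower_bound) (auto simp: admissible_def)
    finally show ?thesis .
  qed
  show ?thesis
  proof (rule field_le_epsilon)
    fix e :: real assume "e > 0"
    then show "1 \<le> (LINT x : ball 0 1 | lebesgue. norm (X x)) + e"
      using lower[of "e / real (2 * m + 2)"] by (simp del: of_nat_add of_nat_mult)
  qed
qed

theorem theorem1p3:
  shows "admissible Xrad \<and>
    (\<forall>X. admissible X \<longrightarrow>
       (LINT x : ball 0 1 | lebesgue. norm (Xrad x)) \<le> (LINT x : ball 0 1 | lebesgue. norm (X x)))"
  using admissible_Xrad admissible_norm_ge_1 by (simp add: integral_norm_Xrad)

end
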